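(* Let $G$ be a Lie group with Lie algebra $\mathfrak g$, and let $H=H(g,\mu,\nu,\xi)$ be a smooth function on the symplectic manifold ${}^{1}T^*T^*G=(G\circledS\mathfrak g_1^* )\circledS(\mathfrak g_2^*\times\mathfrak g_3)$. Hamilton's equation $i_{X_H}\Omega_{{}^{1}T^*T^*G}=-dH$ uniquely determines a Hamiltonian vector field $X_H$, whose value at each point $(g,\mu,\nu,\xi)$ is that of the right invariant vector field generated by the element $$\Big(\frac{\delta H}{\delta\nu},\ \frac{\delta H}{\delta\xi},\ ad^*_{\frac{\delta H}{\delta\mu}}\mu-T_e^*R_g\frac{\delta H}{\delta g},\ -\frac{\delta H}{\delta\mu}\Big)\in(\mathfrak g\circledS\mathfrak g^* )\circledS(\mathfrak g^*\times\mathfrak g)$$ (evaluated at that point), and Hamilton's equations are $$\frac{dg}{dt}=T_eR_g\frac{\delta H}{\delta\nu},\qquad \frac{d\mu}{dt}=\frac{\delta H}{\delta\xi}+ad^*_{\frac{\delta H}{\delta\nu}}\mu,$$ $$\frac{d\nu}{dt}=ad^*_{\frac{\delta H}{\delta\mu}}\mu+ad^*_{\frac{\delta H}{\delta\nu}}\nu-T_e^*R_g\frac{\delta H}{\delta g}-ad^*_\xi\frac{\delta H}{\delta\xi},\qquad \frac{d\xi}{dt}=-\frac{\delta H}{\delta\mu}+\Big[\xi,\frac{\delta H}{\delta\nu}\Big].$$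
   Context: Conventions. $G$ is a (finite-dimensional) Lie group with identity $e$, $\mathfrak g=T_eG$, $\mathfrak g^*$ its dual, $\mathfrak g^{**}=\mathfrak g$. $R_g$ is right translation and $T_e^*R_g:T_g^*G\to\mathfrak g^*$ is the dual of $T_eR_g$. $Ad_g$ is the tangent map at $e$ of $h\mapsto g^{-1}hg$; the Lie bracket is $[\xi,\eta]=ad_\xi\eta=\frac{d}{dt}|_{t=0}Ad_{\exp(t\xi)}\eta$ (the bracket of right invariant vector fields). $ad^*_\xi$ is defined by $\langle ad^*_\xi\mu,\eta\rangle=\langle\mu,[\xi,\eta]\rangle$. Partial derivatives: $\delta H/\delta g\in T_g^*G$, $\delta H/\delta\mu,\delta H/\delta\nu\in\mathfrak g$, $\delta H/\delta\xi\in\mathfrak g^*$. As a manifold ${}^{1}T^*T^*G=G\times\mathfrak g^*\times\mathfrak g^*\times\mathfrak g\ni(g,\mu,\nu,\xi)$ (subscripts on copies are only labels); it is the right trivialization of $T^*(G\circledS\mathfrak g^* )$, where $G\circledS\mathfrak g^*$ is the right trivialization of $T^*G$. The right invariant vector field generated by $(\eta,\lambda_1,\lambda_2,\zeta)\in\mathfrak g\times\mathfrak g^*\times\mathfrak g^*\times\mathfrak g$ is $$X_{(\eta,\lambda_1,\lambda_2,\zeta)}(g,\mu,\nu,\xi)=(T_eR_g\eta,\ \lambda_1+ad^*_\eta\mu,\ \lambda_2+ad^*_\eta\nu-ad^*_\xi\lambda_1,\ \zeta+[\xi,\eta]),$$ and the symplectic form is determined by $$\Omega_{{}^{1}T^*T^*G}(X_{(\eta,\lambda_1,\lambda_2,\zeta)},X_{(\bar\eta,\bar\lambda_1,\bar\lambda_2,\bar\zeta)})=\langle\lambda_2,\bar\eta\rangle+\langle\zeta-[\eta,\xi],\bar\lambda_1\rangle-\langle\bar\lambda_2,\eta\rangle+\langle[\bar\eta,\xi]-\bar\zeta,\lambda_1\rangle+\langle\nu,[\eta,\bar\eta]\rangle.$$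 *)

theory Defs
  imports "HOL-Analysis.Analysis" "HOL-Algebra.Group"
begin

section \<open>Smooth maps between finite-dimensional normed spaces\<close>

text \<open>Meant for open sets \<open>S\<close> and a finite-dimensional domain, where existence and continuity of all
  iterated directional derivatives of Frechet-differentiable functions is \<open>C\<^sup>k\<close> regularity.\<close>

primrec C_on :: "nat \<Rightarrow> 'a::real_normed_vector set \<Rightarrow> ('a \<Rightarrow> 'b::real_normed_vector) \<Rightarrow> bool" where
  "C_on 0 S f \<longleftrightarrow> continuous_on S f"
| "C_on (Suc k) S f \<longleftrightarrow>
     (\<forall>x\<in>S. f differentiable (at x)) \<and> (\<forall>v. C_on k S (\<lambda>x. frechet_derivative f (at x) v))"

definition smooth_on :: "'a::real_normed_vector set \<Rightarrow> ('a \<Rightarrow> 'b::real_normed_vector) \<Rightarrow> bool" where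
  "smooth_on S f \<longleftrightarrow> (\<forall>k. C_on k S f)"

section \<open>Manifolds\<close>

text \<open>A smooth structure is given by an atlas with a preferred chart around every point. A chart is
  a pair of its domain and its coordinate map, which is only relevant on the domain. The tangent
  space at \<open>x\<close> is the model space \<open>'e\<close>, a tangent vector being represented by its components in
  the preferred chart at \<open>x\<close>; accordingly, the cotangent space at \<open>x\<close> is \<open>'e \<Rightarrow>\<^sub>L real\<close>.\<close>

type_synonym ('m, 'e) charts = "'m \<Rightarrow> 'm set \<times> ('m \<Rightarrow> 'e)"

type_synonym 'e dual = "'e \<Rightarrow>\<^sub>L real"

definition chart_dom :: "('m, 'e) charts \<Rightarrow> 'm \<Rightarrow> 'm set" where
  "chart_dom c x = fst (c x)"

definition chart_map :: "('m, 'e) charts \<Rightarrow> 'm \<Rightarrow> 'm \<Rightarrow> 'e" where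
  "chart_map c x = snd (c x)"

definition chart_inv :: "('m, 'e) charts \<Rightarrow> 'm \<Rightarrow> 'e \<Rightarrow> 'm" where
  "chart_inv c x = inv_into (chart_dom c x) (chart_map c x)"

definition smooth_structure ::
    "('m::topological_space, 'e::real_normed_vector) charts \<Rightarrow> bool" where
  "smooth_structure c \<longleftrightarrow>
     (\<forall>x. x \<in> chart_dom c x \<and> open (chart_dom c x) \<and> open (chart_map c x ` chart_dom c x) \<and>
        homeomorphism (chart_dom c x) (chart_map c x ` chart_dom c x)
          (chart_map c x) (chart_inv c x)) \<and>
     (\<forall>x y. smooth_on (chart_map c x ` (chart_dom c x \<inter> chart_dom c y))
        (chart_map c y \<circ> chart_inv c x))"

definition vec_charts :: "('e, 'e) charts" where
  "vec_charts x = (UNIV, id)"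

definition prod_charts :: "('m, 'e) charts \<Rightarrow> ('n, 'f) charts \<Rightarrow> ('m \<times> 'n, 'e \<times> 'f) charts" where
  "prod_charts c d p = (case p of (x, y) \<Rightarrow>
     (chart_dom c x \<times> chart_dom d y, map_prod (chart_map c x) (chart_map d y)))"

definition smooth_map ::
    "('m::topological_space, 'e::real_normed_vector) charts \<Rightarrow>
     ('n::topological_space, 'f::real_normed_vector) charts \<Rightarrow> ('m \<Rightarrow> 'n) \<Rightarrow> bool" where
  "smooth_map c d f \<longleftrightarrow> continuous_on UNIV f \<and>
     (\<forall>x y. smooth_on (chart_map c x ` (chart_dom c x \<inter> f -` chart_dom d y))
        (chart_map d y \<circ> f \<circ> chart_inv c x))"

definition tangent_map ::
    "('m, 'e::real_normed_vector) charts \<Rightarrow> ('n, 'f::real_normed_vector) charts \<Rightarrow>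
     ('m \<Rightarrow> 'n) \<Rightarrow> 'm \<Rightarrow> 'e \<Rightarrow> 'f" where
  "tangent_map c d f x =
     frechet_derivative (chart_map d (f x) \<circ> f \<circ> chart_inv c x) (at (chart_map c x x))"

text \<open>Vector fields assign to \<open>x\<close> components in the preferred chart at \<open>x\<close>, which need not depend
  continuously on \<open>x\<close>; smoothness has to be tested after transforming to one fixed chart.\<close>

definition smooth_vector_field ::
    "('m, 'e::real_normed_vector) charts \<Rightarrow> ('m \<Rightarrow> 'e) \<Rightarrow> bool" where
  "smooth_vector_field c X \<longleftrightarrow>
     (\<forall>x. smooth_on (chart_map c x ` chart_dom c x)
        (\<lambda>y. tangent_map c vec_charts (chart_map c x) (chart_inv c x y) (X (chart_inv c x y))))"

definition has_velocity ::
    "('m::topological_space, 'e::real_normed_vector) charts \<Rightarrow> (real \<Rightarrow> 'm) \<Rightarrow> 'e \<Rightarrow> real \<Rightarrow> bool" where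
  "has_velocity c \<gamma> v t \<longleftrightarrow>
     isCont \<gamma> t \<and> ((\<lambda>s. chart_map c (\<gamma> t) (\<gamma> s)) has_vector_derivative v) (at t)"

definition integral_curve ::
    "('m::topological_space, 'e::real_normed_vector) charts \<Rightarrow> ('m \<Rightarrow> 'e) \<Rightarrow> real set \<Rightarrow>
     (real \<Rightarrow> 'm) \<Rightarrow> bool" where
  "integral_curve c X I \<gamma> \<longleftrightarrow> (\<forall>t\<in>I. has_velocity c \<gamma> (X (\<gamma> t)) t)"

section \<open>Lie groups\<close>

record ('g, 'e) charted_group = "'g monoid" +
  charts :: "('g, 'e) charts"

text \<open>The model space is any finite-dimensional inner product space (completeness is then
  automatic), rather than one of class \<open>euclidean_space\<close>, since the latter excludes dimension 0.\<close>

locale lie_group = group G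
  for G :: "('g::{t2_space, second_countable_topology}, 'e::{real_inner, complete_space})
    charted_group" (structure) +
  assumes carrier_UNIV: "carrier G = UNIV"
    and finite_dim: "\<exists>B :: 'e set. finite B \<and> span B = UNIV"
    and smooth_structure: "smooth_structure (charts G)"
    and smooth_mult:
      "smooth_map (prod_charts (charts G) (charts G)) (charts G) (\<lambda>(g, h). g \<otimes> h)"
    and smooth_inv: "smooth_map (charts G) (charts G) (\<lambda>g. inv g)"

text \<open>The Lie algebra, i.e. the tangent space at \<open>\<one>\<close>, is \<open>'e\<close> (through the preferred chart at
  \<open>\<one>\<close>).\<close>

definition TR :: "('g, 'e::real_normed_vector) charted_group \<Rightarrow> 'g \<Rightarrow> 'e \<Rightarrow> 'e" where
  "TR G g = tangent_map (charts G) (charts G) (\<lambda>h. h \<otimes>\<^bsub>G\<^esub> g) \<one>\<^bsub>G\<^esub>"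

definition TR_dual :: "('g, 'e::real_normed_vector) charted_group \<Rightarrow> 'g \<Rightarrow> 'e dual \<Rightarrow> 'e dual" where
  "TR_dual G g \<alpha> = Blinfun (\<lambda>\<eta>. blinfun_apply \<alpha> (TR G g \<eta>))"

definition Ad :: "('g, 'e::real_normed_vector) charted_group \<Rightarrow> 'g \<Rightarrow> 'e \<Rightarrow> 'e" where
  "Ad G g = tangent_map (charts G) (charts G) (\<lambda>h. inv\<^bsub>G\<^esub> g \<otimes>\<^bsub>G\<^esub> h \<otimes>\<^bsub>G\<^esub> g) \<one>\<^bsub>G\<^esub>"

definition lie_exp :: "('g::topological_space, 'e::real_normed_vector) charted_group \<Rightarrow> 'e \<Rightarrow> 'g"
  where
  "lie_exp G \<xi> =
     (THE \<gamma>. \<gamma> 0 = \<one>\<^bsub>G\<^esub> \<and> integral_curve (charts G) (\<lambda>g. TR G g \<xi>) UNIV \<gamma>) 1"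

definition lie_bracket ::
    "('g::topological_space, 'e::real_normed_vector) charted_group \<Rightarrow> 'e \<Rightarrow> 'e \<Rightarrow> 'e" where
  "lie_bracket G \<xi> \<eta> = vector_derivative (\<lambda>t. Ad G (lie_exp G (t *\<^sub>R \<xi>)) \<eta>) (at 0)"

definition ad_star ::
    "('g::topological_space, 'e::real_normed_vector) charted_group \<Rightarrow> 'e \<Rightarrow> 'e dual \<Rightarrow> 'e dual" where
  "ad_star G \<xi> \<mu> = Blinfun (\<lambda>\<eta>. blinfun_apply \<mu> (lie_bracket G \<xi> \<eta>))"

section \<open>The right trivialization of \<open>T\<^sup>*(G \<circledS> \<gg>\<^sup>*)\<close>\<close>

type_synonym ('g, 'e) phase = "'g \<times> 'e dual \<times> 'e dual \<times> 'e"

type_synonym 'e phase_tangent = "'e \<times> 'e dual \<times> 'e dual \<times> 'e"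

definition phase_charts ::
    "('g, 'e::real_normed_vector) charted_group \<Rightarrow> (('g, 'e) phase, 'e phase_tangent) charts" where
  "phase_charts G = prod_charts (charts G) vec_charts"

fun right_invariant_field ::
    "('g::topological_space, 'e::real_normed_vector) charted_group \<Rightarrow> 'e phase_tangent \<Rightarrow>
     ('g, 'e) phase \<Rightarrow> 'e phase_tangent" where
  "right_invariant_field G (\<eta>, \<kappa>\<^sub>1, \<kappa>\<^sub>2, \<zeta>) (g, \<mu>, \<nu>, \<xi>) =
     (TR G g \<eta>,
      \<kappa>\<^sub>1 + ad_star G \<eta> \<mu>,
      \<kappa>\<^sub>2 + ad_star G \<eta> \<nu> - ad_star G \<xi> \<kappa>\<^sub>1,
      \<zeta> + lie_bracket G \<xi> \<eta>)"

text \<open>Every tangent vector at \<open>p\<close> is the value of a unique right invariant field, so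
  the symplectic form may be given through generators.\<close>

definition generator ::
    "('g::topological_space, 'e::real_normed_vector) charted_group \<Rightarrow> ('g, 'e) phase \<Rightarrow>
     'e phase_tangent \<Rightarrow> 'e phase_tangent" where
  "generator G p v = (THE a. right_invariant_field G a p = v)"

fun symplectic_on_generators ::
    "('g::topological_space, 'e::real_normed_vector) charted_group \<Rightarrow> ('g, 'e) phase \<Rightarrow>
     'e phase_tangent \<Rightarrow> 'e phase_tangent \<Rightarrow> real" where
  "symplectic_on_generators G (g, \<mu>, \<nu>, \<xi>) (\<eta>, \<kappa>\<^sub>1, \<kappa>\<^sub>2, \<zeta>) (\<eta>', \<kappa>\<^sub>1', \<kappa>\<^sub>2', \<zeta>') =
     blinfun_apply \<kappa>\<^sub>2 \<eta>'
     + blinfun_apply \<kappa>\<^sub>1' (\<zeta> - lie_bracket G \<eta> \<xi>)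
     - blinfun_apply \<kappa>\<^sub>2' \<eta>
     + blinfun_apply \<kappa>\<^sub>1 (lie_bracket G \<eta>' \<xi> - \<zeta>')
     + blinfun_apply \<nu> (lie_bracket G \<eta> \<eta>')"

definition symplectic_form ::
    "('g::topological_space, 'e::real_normed_vector) charted_group \<Rightarrow> ('g, 'e) phase \<Rightarrow>
     'e phase_tangent \<Rightarrow> 'e phase_tangent \<Rightarrow> real" where
  "symplectic_form G p v w = symplectic_on_generators G p (generator G p v) (generator G p w)"

definition satisfies_hamilton_equation ::
    "('g::topological_space, 'e::real_normed_vector) charted_group \<Rightarrow>
     (('g, 'e) phase \<Rightarrow> real) \<Rightarrow> (('g, 'e) phase \<Rightarrow> 'e phase_tangent) \<Rightarrow> bool" where
  "satisfies_hamilton_equation G H X \<longleftrightarrow>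
     (\<forall>p w. symplectic_form G p (X p) w = - tangent_map (phase_charts G) vec_charts H p w)"

definition hamiltonian_vector_field ::
    "('g::topological_space, 'e::real_normed_vector) charted_group \<Rightarrow>
     (('g, 'e) phase \<Rightarrow> real) \<Rightarrow> ('g, 'e) phase \<Rightarrow> 'e phase_tangent" where
  "hamiltonian_vector_field G H =
     (THE X. smooth_vector_field (phase_charts G) X \<and> satisfies_hamilton_equation G H X)"

section \<open>Partial derivatives\<close>

fun \<delta>g :: "('g, 'e::real_normed_vector) charted_group \<Rightarrow> (('g, 'e) phase \<Rightarrow> real) \<Rightarrow>
    ('g, 'e) phase \<Rightarrow> 'e dual" where
  "\<delta>g G H (g, \<mu>, \<nu>, \<xi>) = Blinfun (tangent_map (charts G) vec_charts (\<lambda>h. H (h, \<mu>, \<nu>, \<xi>)) g)"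

text \<open>The derivatives in the two dual variables are elements of \<open>\<gg>\<^sup>*\<^sup>* = \<gg>\<close>.\<close>

fun \<delta>\<mu> :: "(('g, 'e::real_normed_vector) phase \<Rightarrow> real) \<Rightarrow> ('g, 'e) phase \<Rightarrow> 'e" where
  "\<delta>\<mu> H (g, \<mu>, \<nu>, \<xi>) =
     (THE \<zeta>. \<forall>\<kappa>. blinfun_apply \<kappa> \<zeta> = frechet_derivative (\<lambda>m. H (g, m, \<nu>, \<xi>)) (at \<mu>) \<kappa>)"

fun \<delta>\<nu> :: "(('g, 'e::real_normed_vector) phase \<Rightarrow> real) \<Rightarrow> ('g, 'e) phase \<Rightarrow> 'e" where
  "\<delta>\<nu> H (g, \<mu>, \<nu>, \<xi>) =
     (THE \<zeta>. \<forall>\<kappa>. blinfun_apply \<kappa> \<zeta> = frechet_derivative (\<lambda>n. H (g, \<mu>, n, \<xi>)) (at \<nu>) \<kappa>)"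

fun \<delta>\<xi> :: "(('g, 'e::real_normed_vector) phase \<Rightarrow> real) \<Rightarrow> ('g, 'e) phase \<Rightarrow> 'e dual" where
  "\<delta>\<xi> H (g, \<mu>, \<nu>, \<xi>) = Blinfun (frechet_derivative (\<lambda>x. H (g, \<mu>, \<nu>, x)) (at \<xi>))"

end

theory Submission
  imports Defs
begin

text \<open>Right invariant fields trivialize the tangent bundle of the phase space, and in terms of generators
  the symplectic form is nondegenerate. Hence Hamilton's equation has at most one solution, and inserting
  the proposed generator solves it as soon as the bracket is bilinear and alternating. As the bracket is
  defined through \<open>Ad\<close> and the exponential map, this requires the one-parameter subgroups: a local
  integral curve through the identity is provided by Picard iteration and extended to the real line by
  \<open>\<gamma>(t) = c(t / 2\<^sup>n) ^ 2\<^sup>n\<close>. Then \<open>[\<xi>, \<eta>]\<close> is the derivative at \<open>\<one>\<close> of \<open>g \<mapsto> Ad\<^sub>g \<eta>\<close>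
  in the direction \<open>\<xi>\<close>, so it is bilinear, and \<open>[\<xi>, \<xi>] = 0\<close> because \<open>exp(t\<xi>)\<close> commutes with \<open>exp(s\<xi>)\<close>.\<close>

section \<open>Finite frames\<close>

text \<open>A tangent vector at \<open>x\<close> is given by components in the chart preferred at
  \<open>x\<close>, and that chart may jump with \<open>x\<close>. Hence neither
  \<open>TR G g \<eta>\<close> nor \<open>\<delta>g G H p\<close> need depend continuously on the
  base point, and every smoothness claim is made in one fixed chart; \<open>right_field\<close> and
  \<open>H_rep\<close> serve this purpose. Smoothness of the solution is an obligation of its own,
  because \<open>hamiltonian_vector_field\<close> is a definite description that asks for it.
  Likewise \<open>lie_exp\<close> is a definite description, so the bracket has no usable value
  before global integral curves are known to exist and to be unique. The model space offers only an
  inner product and a finite spanning set, possibly empty. Coordinates therefore come from frames.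
  They also reconcile \<open>C_on\<close>, which differentiates in fixed directions, with the chain
  rule and the invariant fields, whose directions move with the point: a moving direction is
  expanded into fixed ones with varying coefficients.\<close>

text \<open>The vectors \<open>b i\<close> need not be independent. The index type is arbitrary, so that the frame of a
  product can be indexed by a sum type.\<close>

definition frame :: "'i set \<Rightarrow> ('i \<Rightarrow> 'a::real_normed_vector \<Rightarrow> real) \<Rightarrow> ('i \<Rightarrow> 'a) \<Rightarrow> bool" where
  "frame I \<phi> b \<longleftrightarrow> finite I \<and> (\<forall>i. bounded_linear (\<phi> i)) \<and> (\<forall>x. (\<Sum>i\<in>I. \<phi> i x *\<^sub>R b i) = x)"

lemma frame_finite: "frame I \<phi> b \<Longrightarrow> finite I"
  and frame_bounded_linear: "frame I \<phi> b \<Longrightarrow> bounded_linear (\<phi> i)"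
  and frame_expand: "frame I \<phi> b \<Longrightarrow> (\<Sum>i\<in>I. \<phi> i x *\<^sub>R b i) = x"
  by (auto simp: frame_def)

lemma frame_orthogonal:
  fixes C :: "'a::real_inner set"
  assumes "finite C" "span C = UNIV" "pairwise orthogonal C"
  shows "frame C (\<lambda>c x. inner x c / inner c c) (\<lambda>c. c)"
proof -
  have "(\<Sum>c\<in>C. (inner x c / inner c c) *\<^sub>R c) = x" for x
  proof -
    have "x \<in> span C" using assms by auto
    then obtain u where u: "x = (\<Sum>c\<in>C. u c *\<^sub>R c)"
      using span_finite[OF assms(1)] by auto
    have "(inner x c / inner c c) *\<^sub>R c = u c *\<^sub>R c" if c: "c \<in> C" for c
    \<comment> \<open>An orthogonal set may contain the zero vector; its term vanishes whatever the
      coefficient is.\<close>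
    proof (cases "c = 0")
      case False
      have "inner x c = (\<Sum>d\<in>C. u d * inner d c)" by (simp add: u inner_sum_left)
      also have "\<dots> = (\<Sum>d\<in>C. if d = c then u c * inner c c else 0)"
        using assms(3) c by (intro sum.cong) (auto simp: pairwise_def orthogonal_def)
      also have "\<dots> = u c * inner c c" using c assms(1) by simp
      finally show ?thesis using False by simp
    qed simp
    then show ?thesis by (simp only: u[symmetric] cong: sum.cong)
  qed
  moreover have "bounded_linear (\<lambda>x. inner x c / inner c c)" for c :: 'a
    by (rule bounded_linear_divide[THEN bounded_linear_compose])
      (rule bounded_linear_inner_left)
  ultimately show ?thesis using assms(1) by (auto simp: frame_def)
qed

lemma frame_exists:
  assumes "\<exists>B :: 'a::real_inner set. finite B \<and> span B = UNIV"
  shows "\<exists>(C :: 'a set) \<phi>. frame C \<phi> (\<lambda>c. c)"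
proof -
  obtain B :: "'a set" where B: "finite B" "span B = UNIV" using assms by auto
  obtain C where "finite C" "span C = span B" "pairwise orthogonal C"
    using basis_orthogonal[OF B(1)] by blast
  with B(2) show ?thesis using frame_orthogonal by blast
qed

lemma frame_Times:
  assumes "frame I \<phi> b" "frame J \<psi> d"
  shows "frame (I <+> J) (case_sum (\<lambda>i p. \<phi> i (fst p)) (\<lambda>j p. \<psi> j (snd p)))
    (case_sum (\<lambda>i. (b i, 0)) (\<lambda>j. (0, d j)))"
proof -
  have "bounded_linear (case_sum (\<lambda>i p. \<phi> i (fst p)) (\<lambda>j p. \<psi> j (snd p)) k)" for k
    using assms by (cases k)
      (auto simp: frame_def intro: bounded_linear_compose bounded_linear_fst bounded_linear_snd)
  moreover have "(\<Sum>k\<in>I <+> J. case_sum (\<lambda>i p. \<phi> i (fst p)) (\<lambda>j p. \<psi> j (snd p)) k x *\<^sub>R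
    case_sum (\<lambda>i. (b i, 0)) (\<lambda>j. (0, d j)) k) = x" for x
    using assms by (simp add: frame_def sum.Plus prod_eq_iff fst_sum snd_sum)
  ultimately show ?thesis using assms by (simp add: frame_def)
qed

text \<open>Evaluating \<open>\<alpha>\<close> on the expansion of \<open>x\<close> shows that the
  coordinate functionals span the dual space, with the evaluations at \<open>b i\<close> as
  coefficients.\<close>

lemma frame_dual:
  assumes "frame I \<phi> b"
  shows "frame I (\<lambda>i \<alpha>. blinfun_apply \<alpha> (b i)) (\<lambda>i. Blinfun (\<phi> i))"
proof -
  have "(\<Sum>i\<in>I. blinfun_apply \<alpha> (b i) *\<^sub>R Blinfun (\<phi> i)) = \<alpha>" for \<alpha>
  proof (rule blinfun_eqI)
    fix x
    have "blinfun_apply (\<Sum>i\<in>I. blinfun_apply \<alpha> (b i) *\<^sub>R Blinfun (\<phi> i)) x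
      = (\<Sum>i\<in>I. \<alpha> (b i) * \<phi> i x)"
      using assms by (simp add: blinfun.sum_left blinfun.scaleR_left frame_def
          bounded_linear_Blinfun_apply)
    also have "\<dots> = \<alpha> (\<Sum>i\<in>I. \<phi> i x *\<^sub>R b i)"
      by (simp add: blinfun.sum_right blinfun.scaleR_right mult.commute)
    finally show "blinfun_apply (\<Sum>i\<in>I. blinfun_apply \<alpha> (b i) *\<^sub>R Blinfun (\<phi> i)) x = \<alpha> x"
      using assms by (simp add: frame_def)
  qed
  moreover have "bounded_linear (\<lambda>\<alpha>. blinfun_apply \<alpha> (b i))" for i
    by (intro bounded_linear_intros bounded_linear_ident)
  ultimately show ?thesis using assms by (simp add: frame_def)
qed

lemma linear_frame_expand:
  fixes b :: "'i \<Rightarrow> 'a::real_normed_vector"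
  assumes "frame I \<phi> b" and "linear (f :: 'a \<Rightarrow> _)"
  shows "f x = (\<Sum>i\<in>I. \<phi> i x *\<^sub>R f (b i))"
  using linear_sum[OF assms(2), of "\<lambda>i. \<phi> i x *\<^sub>R b i" I]
  by (simp add: linear_cmul[OF assms(2)] frame_expand[OF assms(1)])

text \<open>Through the frame, a linear map is a finite sum of bounded functionals times fixed
  vectors: the automatic continuity of linear maps in finite dimension.\<close>

lemma frame_linear_bounded:
  fixes b :: "'i \<Rightarrow> 'a::real_normed_vector" and f :: "'a \<Rightarrow> 'c::real_normed_vector"
  assumes "frame I \<phi> b" "linear f"
  shows "bounded_linear f"
proof -
  have "bounded_linear (\<lambda>x. \<Sum>i\<in>I. \<phi> i x *\<^sub>R f (b i))"
    by (rule bounded_linear_sum)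
      (rule bounded_linear_scaleR_const[OF frame_bounded_linear[OF assms(1)]])
  moreover have "(\<lambda>x. \<Sum>i\<in>I. \<phi> i x *\<^sub>R f (b i)) = f"
    by (rule ext) (rule linear_frame_expand[OF assms, symmetric])
  ultimately show ?thesis by simp
qed

text \<open>Only the finitely many maps \<open>B (b i)\<close> enter, each bounded by linearity.
  This makes the bracket and \<open>ad_star\<close> continuous by their algebra alone.\<close>

lemma frame_bilinear_bounded:
  fixes B :: "'a::real_normed_vector \<Rightarrow> 'b::real_normed_vector \<Rightarrow> 'c::real_normed_vector"
    and b :: "'i \<Rightarrow> 'a" and d :: "'j \<Rightarrow> 'b"
  assumes I: "frame I \<phi> b" and J: "frame J \<psi> d"
    and l: "\<And>y. linear (\<lambda>x. B x y)" and r: "\<And>x. linear (B x)"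
  shows "bounded_bilinear B"
proof -
  obtain K where K: "\<And>i x. i \<in> I \<Longrightarrow> norm (\<phi> i x) \<le> norm x * K i"
    using bounded_linear.bounded[OF frame_bounded_linear[OF I]] by metis
  obtain L where L: "\<And>i x. norm (B (b i) x) \<le> norm x * L i"
  proof -
    have "\<forall>i. \<exists>L. \<forall>x. norm (B (b i) x) \<le> norm x * L"
      using bounded_linear.bounded[OF frame_linear_bounded[OF J r]] by blast
    then show ?thesis using that by metis
  qed
  have "norm (B x y) \<le> norm x * norm y * (\<Sum>i\<in>I. K i * L i)" for x y
  proof -
    have "B x y = (\<Sum>i\<in>I. \<phi> i x *\<^sub>R B (b i) y)" by (rule linear_frame_expand[OF I l])
    also have "norm \<dots> \<le> (\<Sum>i\<in>I. (norm x * K i) * (norm y * L i))"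
      by (rule sum_norm_le) (use K L in \<open>auto intro!: mult_mono order_trans[OF norm_ge_zero K]\<close>)
    also have "\<dots> = norm x * norm y * (\<Sum>i\<in>I. K i * L i)"
      by (simp add: sum_distrib_left mult_ac)
    finally show ?thesis .
  qed
  then show ?thesis
    by unfold_locales
      (auto simp: linear_add[OF l] linear_add[OF r] linear_cmul[OF l] linear_cmul[OF r])
qed

section \<open>Calculus of smooth maps\<close>

lemma C_on_subset: "C_on k S f \<Longrightarrow> T \<subseteq> S \<Longrightarrow> C_on k T f"
  by (induct k arbitrary: f) (auto intro: continuous_on_subset)

text \<open>Openness of \<open>S\<close> makes the derivative at a point depend only on values in
  \<open>S\<close>, so agreement passes to all orders.\<close>

lemma C_on_cong:
  assumes "open S" "\<And>x. x \<in> S \<Longrightarrow> f x = g x"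
  shows "C_on k S f \<longleftrightarrow> C_on k S g"
  using assms(2)
proof (induct k arbitrary: f g)
  case 0
  then show ?case by (simp cong: continuous_on_cong)
next
  case (Suc k)
  have d: "f differentiable at x \<longleftrightarrow> g differentiable at x" if "x \<in> S" for x
    using that Suc.prems assms(1) unfolding differentiable_def
    by (metis has_derivative_transform_within_open)
  have e: "frechet_derivative f (at x) = frechet_derivative g (at x)"
    if "x \<in> S" "f differentiable at x" for x
    using that Suc.prems assms(1) by (intro frechet_derivative_transform_within_open)
  show ?case
  proof (cases "\<forall>x\<in>S. f differentiable at x")
    case True
    then have "C_on k S (\<lambda>x. frechet_derivative f (at x) v) \<longleftrightarrow>
      C_on k S (\<lambda>x. frechet_derivative g (at x) v)" for v
      using e by (intro Suc.hyps) auto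
    then show ?thesis using d by auto
  qed (use d in auto)
qed

lemma C_on_Suc_imp: "C_on (Suc k) S f \<Longrightarrow> C_on k S f"
proof (induct k arbitrary: f)
  case 0
  then show ?case
    using differentiable_imp_continuous_within continuous_at_imp_continuous_on
    by (metis C_on.simps)
next
  case (Suc k)
  then show ?case by (metis C_on.simps(2))
qed

lemma C_on_SucI:
  assumes "open S" "\<And>x. x \<in> S \<Longrightarrow> (f has_derivative f' x) (at x)"
    and "\<And>v. C_on k S (\<lambda>x. f' x v)"
  shows "C_on (Suc k) S f"
proof -
  have "C_on k S (\<lambda>x. frechet_derivative f (at x) v)" for v
  proof -
    have "f' x v = frechet_derivative f (at x) v" if "x \<in> S" for x
      using frechet_derivative_at[OF assms(2)[OF that]] by simp
    from C_on_cong[OF assms(1), of "\<lambda>x. f' x v", OF this] assms(3)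
    show ?thesis by (rule iffD1)
  qed
  then show ?thesis using assms(2) by (auto simp: differentiable_def)
qed

lemma C_on_SucD:
  assumes "C_on (Suc k) S f" "x \<in> S"
  shows "(f has_derivative frechet_derivative f (at x)) (at x)"
  using assms by (auto simp: frechet_derivative_works)

lemma C_on_const: "open S \<Longrightarrow> C_on k S (\<lambda>x. c)"
proof (induct k arbitrary: c)
  case (Suc k)
  then show ?case by (intro C_on_SucI[where f' = "\<lambda>x v. 0"]) auto
qed simp

lemma C_on_bounded_linear:
  assumes "open S" "bounded_linear f"
  shows "C_on k S f"
proof (cases k)
  case 0
  then show ?thesis using assms by (simp add: linear_continuous_on)
next
  case (Suc n)
  show ?thesis unfolding Suc
    by (rule C_on_SucI[OF assms(1), where f' = "\<lambda>x. f"])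
      (simp_all add: assms C_on_const bounded_linear_imp_has_derivative)
qed

lemma C_on_add:
  assumes "open S" "C_on k S f" "C_on k S g"
  shows "C_on k S (\<lambda>x. f x + g x)"
  using assms(2,3)
proof (induct k arbitrary: f g)
  case 0
  then show ?case by (auto intro: continuous_intros)
next
  case (Suc k)
  show ?case
    by (rule C_on_SucI[OF assms(1) has_derivative_add])
      (use Suc in \<open>auto intro: C_on_SucD\<close>)
qed

lemma C_on_sum:
  assumes "open S" "\<And>i. i \<in> I \<Longrightarrow> C_on k S (f i)"
  shows "C_on k S (\<lambda>x. \<Sum>i\<in>I. f i x)"
  using assms(2)
  by (induct I rule: infinite_finite_induct) (auto intro: C_on_add C_on_const assms(1))

lemma C_on_bilinear:
  assumes B: "bounded_bilinear B" and "open S" "C_on k S f" "C_on k S g"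
  shows "C_on k S (\<lambda>x. B (f x) (g x))"
  using assms(3,4)
proof (induct k arbitrary: f g)
  case 0
  then show ?case by (auto intro: bounded_bilinear.continuous_on[OF B])
next
  case (Suc k)
  show ?case
  proof (rule C_on_SucI[OF assms(2) bounded_bilinear.FDERIV[OF B]])
    show "C_on k S (\<lambda>x. B (f x) (frechet_derivative g (at x) v) + B (frechet_derivative f (at x) v) (g x))"
      for v
      using Suc C_on_Suc_imp[OF Suc.prems(1)] C_on_Suc_imp[OF Suc.prems(2)]
      by (intro C_on_add assms(2) Suc.hyps) auto
  qed (use Suc.prems in \<open>auto intro: C_on_SucD\<close>)
qed

lemma C_on_compose_linear:
  assumes L: "bounded_linear L" and "open S" "C_on k S f"
  shows "C_on k S (\<lambda>x. L (f x))"
  using assms(3)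
proof (induct k arbitrary: f)
  case 0
  then show ?case by (auto intro: bounded_linear.continuous_on[OF L])
next
  case (Suc k)
  show ?case
    by (rule C_on_SucI[OF assms(2) bounded_linear.has_derivative[OF L]])
      (use Suc in \<open>auto intro: C_on_SucD\<close>)
qed

lemma C_on_Pair:
  assumes "open S" "C_on k S f" "C_on k S g"
  shows "C_on k S (\<lambda>x. (f x, g x))"
proof -
  have "bounded_linear (\<lambda>u. (u, 0 :: 'c))" "bounded_linear (\<lambda>v. (0 :: 'b, v))"
    by (auto intro: bounded_linear_Pair bounded_linear_ident bounded_linear_zero)
  from C_on_add[OF assms(1) C_on_compose_linear[OF this(1) assms(1,2)]
      C_on_compose_linear[OF this(2) assms(1,3)]]
   show ?thesis by simp
qed

text \<open>The chain rule differentiates \<open>g\<close> in the direction Df(x) v, which varies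
  with \<open>x\<close>, whereas the induction hypothesis covers fixed directions only. Expanding
  that direction in the frame leaves the fixed directions \<open>b i\<close> with coefficients of
  class C^k.\<close>

lemma C_on_compose:
  fixes f :: "'a::real_normed_vector \<Rightarrow> 'b::real_normed_vector" and b :: "'i \<Rightarrow> 'b"
  assumes F: "frame I \<phi> b" and S: "open S" and "\<And>x. x \<in> S \<Longrightarrow> f x \<in> T"
    and "C_on k S f" "C_on k T g"
  shows "C_on k S (\<lambda>x. g (f x))"
  using assms(4,5)
proof (induct k arbitrary: g)
  case 0
  then show ?case
    using continuous_on_compose2[of T g S f] assms(3) by auto
next
  case (Suc k)
  let ?D = "\<lambda>x v. frechet_derivative g (at (f x)) (frechet_derivative f (at x) v)"
  show ?case
  proof (rule C_on_SucI[OF S, where f' = ?D])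
    fix x assume x: "x \<in> S"
    show "((\<lambda>x. g (f x)) has_derivative ?D x) (at x)"
      using C_on_SucD[OF Suc.prems(1) x] C_on_SucD[OF Suc.prems(2) assms(3)[OF x]]
      by (rule has_derivative_compose)
  next
    fix v
    have "?D x v = (\<Sum>i\<in>I. \<phi> i (frechet_derivative f (at x) v) *\<^sub>R
        frechet_derivative g (at (f x)) (b i))" if "x \<in> S" for x
      using C_on_SucD[OF Suc.prems(2) assms(3)[OF that]]
      by (intro linear_frame_expand[OF F] has_derivative_linear)
    moreover have "C_on k S (\<lambda>x. \<Sum>i\<in>I. \<phi> i (frechet_derivative f (at x) v) *\<^sub>R
        frechet_derivative g (at (f x)) (b i))"
      using Suc.prems
      by (intro C_on_sum S C_on_bilinear[OF bounded_bilinear_scaleR]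
          C_on_compose_linear[OF frame_bounded_linear[OF F]]
          Suc.hyps[of "\<lambda>y. frechet_derivative g (at y) (b _)"] C_on_Suc_imp[of k S f]) auto
    ultimately show "C_on k S (\<lambda>x. ?D x v)" 
      using C_on_cong[OF S, of "\<lambda>x. ?D x v"] by simp
  qed
qed

section \<open>Closure properties of smooth maps\<close>

lemma smooth_on_subset: "smooth_on S f \<Longrightarrow> T \<subseteq> S \<Longrightarrow> smooth_on T f"
  by (auto simp: smooth_on_def intro: C_on_subset)

lemma smooth_on_cong: "open S \<Longrightarrow> (\<And>x. x \<in> S \<Longrightarrow> f x = g x) \<Longrightarrow> smooth_on S f \<longleftrightarrow> smooth_on S g"
  using C_on_cong by (metis smooth_on_def)

lemma smooth_on_const: "open S \<Longrightarrow> smooth_on S (\<lambda>x. c)"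
  by (auto simp: smooth_on_def intro: C_on_const)

lemma smooth_on_linear: "bounded_linear f \<Longrightarrow> open S \<Longrightarrow> smooth_on S f"
  by (auto simp: smooth_on_def intro: C_on_bounded_linear)

lemma smooth_on_compose_linear:
  "bounded_linear L \<Longrightarrow> open S \<Longrightarrow> smooth_on S f \<Longrightarrow> smooth_on S (\<lambda>x. L (f x))"
  by (auto simp: smooth_on_def intro: C_on_compose_linear)

lemma smooth_on_add:
  "open S \<Longrightarrow> smooth_on S f \<Longrightarrow> smooth_on S g \<Longrightarrow> smooth_on S (\<lambda>x. f x + g x)"
  by (auto simp: smooth_on_def intro: C_on_add)

lemma smooth_on_minus: "open S \<Longrightarrow> smooth_on S f \<Longrightarrow> smooth_on S (\<lambda>x. - f x)"
  by (rule smooth_on_compose_linear[OF bounded_linear_minus[OF bounded_linear_ident]])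

lemma smooth_on_diff:
  "open S \<Longrightarrow> smooth_on S f \<Longrightarrow> smooth_on S g \<Longrightarrow> smooth_on S (\<lambda>x. f x - g x)"
  using smooth_on_add[of S f "\<lambda>x. - g x"] smooth_on_minus[of S g] by simp

lemma smooth_on_sum:
  "open S \<Longrightarrow> (\<And>i. i \<in> I \<Longrightarrow> smooth_on S (f i)) \<Longrightarrow> smooth_on S (\<lambda>x. \<Sum>i\<in>I. f i x)"
  by (auto simp: smooth_on_def intro: C_on_sum)

lemma smooth_on_bilinear:
  "bounded_bilinear B \<Longrightarrow> open S \<Longrightarrow> smooth_on S f \<Longrightarrow> smooth_on S g \<Longrightarrow>
    smooth_on S (\<lambda>x. B (f x) (g x))"
  by (auto simp: smooth_on_def intro: C_on_bilinear)

lemma smooth_on_Pair: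
  "open S \<Longrightarrow> smooth_on S f \<Longrightarrow> smooth_on S g \<Longrightarrow> smooth_on S (\<lambda>x. (f x, g x))"
  by (auto simp: smooth_on_def intro: C_on_Pair)

lemma smooth_on_compose:
  fixes f :: "'a::real_normed_vector \<Rightarrow> 'b::real_normed_vector" and b :: "'i \<Rightarrow> 'b"
  shows "frame I \<phi> b \<Longrightarrow> open S \<Longrightarrow> (\<And>x. x \<in> S \<Longrightarrow> f x \<in> T) \<Longrightarrow> smooth_on S f \<Longrightarrow> smooth_on T g \<Longrightarrow>
    smooth_on S (\<lambda>x. g (f x))"
  unfolding smooth_on_def by (blast intro: C_on_compose)

lemma smooth_on_continuous: "smooth_on S f \<Longrightarrow> continuous_on S f"
  unfolding smooth_on_def using C_on.simps(1) by blast

lemma smooth_on_has_derivative: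
  "smooth_on S f \<Longrightarrow> x \<in> S \<Longrightarrow> (f has_derivative frechet_derivative f (at x)) (at x)"
  unfolding smooth_on_def using C_on_SucD by blast

lemma smooth_on_derivative: "smooth_on S f \<Longrightarrow> smooth_on S (\<lambda>x. frechet_derivative f (at x) v)"
  unfolding smooth_on_def using C_on.simps(2) by blast

text \<open>Here both the base point and the direction move; the frame again reduces to fixed
  directions. Smoothness of the invariant fields, of \<open>Ad\<close> and of the partial
  derivatives of \<open>H\<close> is obtained by writing each as such a derivative.\<close>

lemma smooth_on_derivative_apply:
  fixes f :: "'a::real_normed_vector \<Rightarrow> 'b::real_normed_vector" and b :: "'i \<Rightarrow> 'b"
  assumes F: "frame I \<phi> b" and S: "open S" and f: "smooth_on S f" "\<And>x. x \<in> S \<Longrightarrow> f x \<in> T"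
    and g: "smooth_on T g" and v: "smooth_on S v"
  shows "smooth_on S (\<lambda>x. frechet_derivative g (at (f x)) (v x))"
proof -
  have e: "frechet_derivative g (at (f x)) (v x) =
      (\<Sum>i\<in>I. \<phi> i (v x) *\<^sub>R frechet_derivative g (at (f x)) (b i))" if "x \<in> S" for x
    using smooth_on_has_derivative[OF g f(2)[OF that]]
    by (intro linear_frame_expand[OF F] has_derivative_linear)
  have "smooth_on S (\<lambda>x. \<Sum>i\<in>I. \<phi> i (v x) *\<^sub>R frechet_derivative g (at (f x)) (b i))"
  proof (rule smooth_on_sum[OF S], rule smooth_on_bilinear[OF bounded_bilinear_scaleR S])
    show "smooth_on S (\<lambda>x. \<phi> i (v x))" for i
      by (rule smooth_on_compose_linear[OF frame_bounded_linear[OF F] S v])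
    show "smooth_on S (\<lambda>x. frechet_derivative g (at (f x)) (b i))" for i
      by (rule smooth_on_compose[OF F S f(2) f(1) smooth_on_derivative[OF g]])
  qed
  moreover have "smooth_on S (\<lambda>x. frechet_derivative g (at (f x)) (v x)) \<longleftrightarrow>
      smooth_on S (\<lambda>x. \<Sum>i\<in>I. \<phi> i (v x) *\<^sub>R frechet_derivative g (at (f x)) (b i))"
    by (rule smooth_on_cong[OF S]) (rule e)
  ultimately show ?thesis by (rule iffD2[rotated])
qed

section \<open>Calculus of tangent maps\<close>

text \<open>The topological half of \<open>smooth_structure\<close>, without compatibility of
  charts. It suffices for the chain rule and passes directly to products and vector spaces.\<close>

definition charted :: "('m::t2_space, 'e::real_normed_vector) charts \<Rightarrow> bool" where
  "charted c \<longleftrightarrow> (\<forall>x. x \<in> chart_dom c x \<and> open (chart_dom c x) \<and>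
     open (chart_map c x ` chart_dom c x) \<and>
     homeomorphism (chart_dom c x) (chart_map c x ` chart_dom c x) (chart_map c x) (chart_inv c x))"

lemma smooth_structure_charted: "smooth_structure c \<Longrightarrow> charted c"
  by (auto simp: smooth_structure_def charted_def)

context
  fixes c :: "('m::t2_space, 'e::real_normed_vector) charts"
  assumes c: "charted c"
begin

lemma chart_dom_self: "x \<in> chart_dom c x"
  and open_chart_dom: "open (chart_dom c x)"
  and open_chart_image: "open (chart_map c x ` chart_dom c x)"
  and chart_homeomorphism:
    "homeomorphism (chart_dom c x) (chart_map c x ` chart_dom c x) (chart_map c x) (chart_inv c x)"
  using c by (auto simp: charted_def)

lemma chart_inv_map: "y \<in> chart_dom c x \<Longrightarrow> chart_inv c x (chart_map c x y) = y"
  using chart_homeomorphism[of x] by (simp add: homeomorphism_def)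

lemma chart_inv_dom: "a \<in> chart_map c x ` chart_dom c x \<Longrightarrow> chart_inv c x a \<in> chart_dom c x"
  by (auto simp: chart_inv_map)

lemma chart_map_inv: "a \<in> chart_map c x ` chart_dom c x \<Longrightarrow> chart_map c x (chart_inv c x a) = a"
  by (auto simp: chart_inv_map)

lemma isCont_chart_map: "y \<in> chart_dom c x \<Longrightarrow> isCont (chart_map c x) y"
  using chart_homeomorphism[of x] open_chart_dom[of x]
  by (auto simp: homeomorphism_def continuous_on_eq_continuous_at)

lemma continuous_on_chart_inv: "continuous_on (chart_map c x ` chart_dom c x) (chart_inv c x)"
  using chart_homeomorphism[of x] by (simp add: homeomorphism_def)

lemma isCont_chart_inv: "a \<in> chart_map c x ` chart_dom c x \<Longrightarrow> isCont (chart_inv c x) a"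
  using continuous_on_chart_inv[of x] open_chart_image[of x]
  by (auto simp: continuous_on_eq_continuous_at)

lemma chart_map_image_eq:
  assumes "U \<subseteq> chart_dom c x"
  shows "chart_map c x ` U = {a \<in> chart_map c x ` chart_dom c x. chart_inv c x a \<in> U}"
  using assms by (force simp: chart_inv_map)

lemma open_chart_map_image:
  assumes "open U" "U \<subseteq> chart_dom c x"
  shows "open (chart_map c x ` U)"
proof -
  have "open (chart_map c x ` chart_dom c x \<inter> chart_inv c x -` U)"
    by (rule continuous_open_preimage[OF continuous_on_chart_inv open_chart_image assms(1)])
  then show ?thesis
    unfolding chart_map_image_eq[OF assms(2)] by (simp add: Collect_conj_eq vimage_def)
qed

end

lemma vec_charts_simps [simp]:
  "chart_dom vec_charts x = UNIV" "chart_map vec_charts x = id" "chart_inv vec_charts x = id"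
  by (auto simp: chart_dom_def chart_map_def chart_inv_def vec_charts_def inv_id[unfolded id_def] id_def)

lemma charted_vec: "charted vec_charts"
  by (simp add: charted_def homeomorphism_def)

lemma prod_charts_simps [simp]:
  "chart_dom (prod_charts c d) (x, y) = chart_dom c x \<times> chart_dom d y"
  "chart_map (prod_charts c d) (x, y) = map_prod (chart_map c x) (chart_map d y)"
  by (auto simp: chart_dom_def chart_map_def prod_charts_def)

text \<open>\<open>chart_inv\<close> is an \<open>inv_into\<close>, arbitrary off the image of the
  chart, so it splits into components only over the product of the images.\<close>

lemma prod_charts_inv:
  assumes "charted c" "charted d"
    and "a \<in> chart_map c x ` chart_dom c x" "b \<in> chart_map d y ` chart_dom d y"
  shows "chart_inv (prod_charts c d) (x, y) (a, b) = (chart_inv c x a, chart_inv d y b)"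
proof -
  have "inj_on (map_prod (chart_map c x) (chart_map d y)) (chart_dom c x \<times> chart_dom d y)"
    by (rule inj_onI) (auto, metis assms(1) chart_inv_map, metis assms(2) chart_inv_map)
  moreover have "(a, b) = map_prod (chart_map c x) (chart_map d y) (chart_inv c x a, chart_inv d y b)"
    using assms by (simp add: chart_map_inv)
  moreover have "(chart_inv c x a, chart_inv d y b) \<in> chart_dom c x \<times> chart_dom d y"
    using assms by (simp add: chart_inv_dom)
  ultimately show ?thesis
    unfolding chart_inv_def[of "prod_charts c d"] prod_charts_simps by (metis inv_into_f_f)
qed

lemma charted_prod:
  assumes "charted c" "charted d"
  shows "charted (prod_charts c d)"
proof -
  have "p \<in> chart_dom (prod_charts c d) p \<and> open (chart_dom (prod_charts c d) p) \<and>
     open (chart_map (prod_charts c d) p ` chart_dom (prod_charts c d) p) \<and>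
     homeomorphism (chart_dom (prod_charts c d) p)
       (chart_map (prod_charts c d) p ` chart_dom (prod_charts c d) p)
       (chart_map (prod_charts c d) p) (chart_inv (prod_charts c d) p)" for p
  proof (cases p)
    case (Pair x y)
    let ?A = "chart_map c x ` chart_dom c x" and ?B = "chart_map d y ` chart_dom d y"
    have im: "map_prod (chart_map c x) (chart_map d y) ` (chart_dom c x \<times> chart_dom d y) = ?A \<times> ?B"
      by auto
    have inv: "chart_inv (prod_charts c d) (x, y) z = map_prod (chart_inv c x) (chart_inv d y) z"
      if "z \<in> ?A \<times> ?B" for z
      using that prod_charts_inv[OF assms] by (cases z) auto
    have cm: "continuous_on (chart_dom c x \<times> chart_dom d y) (map_prod (chart_map c x) (chart_map d y))"
      using chart_homeomorphism[OF assms(1), of x] chart_homeomorphism[OF assms(2), of y]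
      unfolding map_prod_def case_prod_beta homeomorphism_def
      by (auto intro!: continuous_on_Pair continuous_on_compose2[OF _ continuous_on_fst[OF continuous_on_id]]
          continuous_on_compose2[OF _ continuous_on_snd[OF continuous_on_id]])
    have "continuous_on (?A \<times> ?B) (map_prod (chart_inv c x) (chart_inv d y))"
      using continuous_on_chart_inv[OF assms(1), of x] continuous_on_chart_inv[OF assms(2), of y]
      unfolding map_prod_def case_prod_beta
      by (auto intro!: continuous_on_Pair continuous_on_compose2[OF _ continuous_on_fst[OF continuous_on_id]]
          continuous_on_compose2[OF _ continuous_on_snd[OF continuous_on_id]])
    then have ci: "continuous_on (?A \<times> ?B) (chart_inv (prod_charts c d) (x, y))"
      using inv by (metis (no_types, lifting) continuous_on_cong)
    have "homeomorphism (chart_dom c x \<times> chart_dom d y) (?A \<times> ?B)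
        (map_prod (chart_map c x) (chart_map d y)) (chart_inv (prod_charts c d) (x, y))"
      by (rule homeomorphismI[OF cm ci])
        (auto simp: prod_charts_inv[OF assms] chart_inv_map assms chart_map_inv chart_inv_dom)
    then show ?thesis
      using assms
      by (auto simp: Pair im open_Times chart_dom_self open_chart_dom open_chart_image)
  qed
  then show ?thesis unfolding charted_def by blast
qed

text \<open>\<open>tangent_map\<close> is total and says nothing about differentiability; the
  relation asserts it. Continuity is included because it keeps \<open>f\<close> near
  \<open>x\<close> inside the domain of the chart at \<open>f x\<close>, outside of which
  \<open>chart_map\<close> is meaningless.\<close>

definition has_tangent_map ::
    "('m::t2_space, 'e::real_normed_vector) charts \<Rightarrow>
     ('n::t2_space, 'f::real_normed_vector) charts \<Rightarrow> ('m \<Rightarrow> 'n) \<Rightarrow> 'm \<Rightarrow> ('e \<Rightarrow> 'f) \<Rightarrow> bool"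
  where
  "has_tangent_map c d f x D \<longleftrightarrow> isCont f x \<and>
     ((chart_map d (f x) \<circ> f \<circ> chart_inv c x) has_derivative D) (at (chart_map c x x))"

lemma has_tangent_map_eq: "has_tangent_map c d f x D \<Longrightarrow> tangent_map c d f x = D"
  by (simp add: has_tangent_map_def tangent_map_def frechet_derivative_at[symmetric])

lemma has_tangent_map_unique: "has_tangent_map c d f x D \<Longrightarrow> has_tangent_map c d f x E \<Longrightarrow> D = E"
  using has_tangent_map_eq by metis

lemma has_tangent_map_linear: "has_tangent_map c d f x D \<Longrightarrow> bounded_linear D"
  by (auto simp: has_tangent_map_def has_derivative_bounded_linear)

lemma chart_has_derivative_transform:
  assumes c: "charted c" and U: "open U" "x \<in> U" and eq: "\<And>y. y \<in> U \<Longrightarrow> f y = g y"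
    and f: "((f \<circ> chart_inv c x) has_derivative D) (at (chart_map c x x))"
  shows "((g \<circ> chart_inv c x) has_derivative D) (at (chart_map c x x))"
  using f
proof (rule has_derivative_transform_within_open)
  show "open (chart_map c x ` (U \<inter> chart_dom c x))"
    by (rule open_chart_map_image[OF c]) (auto simp: U open_chart_dom[OF c])
  show "chart_map c x x \<in> chart_map c x ` (U \<inter> chart_dom c x)"
    using U chart_dom_self[OF c] by auto
qed (auto simp: chart_inv_map[OF c] eq)

lemma has_tangent_map_transform:
  assumes c: "charted c" and U: "open U" "x \<in> U" and eq: "\<And>y. y \<in> U \<Longrightarrow> f y = g y"
    and f: "has_tangent_map c d f x D"
  shows "has_tangent_map c d g x D"
proof -
  have "isCont g x"
  proof -
    have "eventually (\<lambda>y. f y = g y) (nhds x)"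
      using U eq by (auto simp: eventually_nhds)
    from isCont_cong[OF this] show ?thesis using f by (simp add: has_tangent_map_def)
  qed
  then show ?thesis
    using f chart_has_derivative_transform[OF c U, of "chart_map d (f x) \<circ> f" "chart_map d (g x) \<circ> g"]
      eq U by (simp add: has_tangent_map_def)
qed

lemma has_tangent_map_compose:
  assumes c: "charted c" and d: "charted d"
    and f: "has_tangent_map c d f x D" and g: "has_tangent_map d e g (f x) E"
  shows "has_tangent_map c e (\<lambda>y. g (f y)) x (\<lambda>v. E (D v))"
proof -
  let ?\<phi> = "chart_map e (g (f x))"
  have cont: "isCont f x" "isCont g (f x)" using f g by (auto simp: has_tangent_map_def)
  \<comment> \<open>On \<open>U\<close> the values of \<open>f\<close> stay in the chart domain at
    \<open>f x\<close>, so the pair \<open>chart_inv d (f x)\<close> after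
    \<open>chart_map d (f x)\<close> inserted between \<open>g\<close> and \<open>f\<close>
    cancels.\<close>
  obtain U where U: "open U" "x \<in> U" "\<And>y. y \<in> U \<Longrightarrow> f y \<in> chart_dom d (f x)"
    using cont(1) open_chart_dom[OF d, of "f x"] chart_dom_self[OF d, of "f x"]
    unfolding continuous_at_open by meson
  have "((\<lambda>a. (?\<phi> \<circ> g \<circ> chart_inv d (f x)) ((chart_map d (f x) \<circ> f \<circ> chart_inv c x) a))
      has_derivative (\<lambda>v. E (D v))) (at (chart_map c x x))"
    by (rule has_derivative_compose[where f = "chart_map d (f x) \<circ> f \<circ> chart_inv c x"])
      (use f g in \<open>auto simp: has_tangent_map_def o_def chart_inv_map[OF c] chart_dom_self[OF c]\<close>)
  then have "(((\<lambda>y. ?\<phi> (g (chart_inv d (f x) (chart_map d (f x) (f y))))) \<circ> chart_inv c x)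
      has_derivative (\<lambda>v. E (D v))) (at (chart_map c x x))"
    by (simp add: o_def)
  then have "(((\<lambda>y. ?\<phi> (g (f y))) \<circ> chart_inv c x) has_derivative (\<lambda>v. E (D v)))
      (at (chart_map c x x))"
    by (rule chart_has_derivative_transform[OF c U(1,2), rotated]) (simp add: chart_inv_map[OF d] U(3))
  then show ?thesis
    using isCont_o2[OF cont] by (simp add: has_tangent_map_def o_def)
qed

lemma has_tangent_map_ident: 
  assumes c: "charted c"
  shows "has_tangent_map c c (\<lambda>x. x) x (\<lambda>v. v)"
proof -
  have "((\<lambda>a. a) has_derivative (\<lambda>v. v)) (at (chart_map c x x))" by simp
  then have "((chart_map c x \<circ> chart_inv c x) has_derivative (\<lambda>v. v)) (at (chart_map c x x))"
    by (rule has_derivative_transform_within_open[OF _ open_chart_image[OF c]])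
      (auto simp: chart_inv_map[OF c] chart_dom_self[OF c])
  then show ?thesis by (simp add: has_tangent_map_def o_def)
qed

lemma has_tangent_map_const: "has_tangent_map c d (\<lambda>x. k) x (\<lambda>v. 0)"
  by (simp add: has_tangent_map_def o_def)

lemma has_tangent_map_Pair:
  assumes "has_tangent_map c d f x D" "has_tangent_map c e g x E"
  shows "has_tangent_map c (prod_charts d e) (\<lambda>y. (f y, g y)) x (\<lambda>v. (D v, E v))"
  using assms by (auto simp: has_tangent_map_def o_def intro!: has_derivative_Pair continuous_intros)

lemma has_tangent_map_fst:
  assumes c: "charted c" and d: "charted d"
  shows "has_tangent_map (prod_charts c d) c fst p fst"
proof (cases p)
  case (Pair x y)
  let ?A = "chart_map c x ` chart_dom c x" and ?B = "chart_map d y ` chart_dom d y"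
  have "(fst has_derivative fst) (at (chart_map c x x, chart_map d y y))"
    by (rule bounded_linear_imp_has_derivative[OF bounded_linear_fst])
  then have "((chart_map c x \<circ> fst \<circ> chart_inv (prod_charts c d) (x, y)) has_derivative fst)
      (at (chart_map c x x, chart_map d y y))"
    by (rule has_derivative_transform_within_open[where s = "?A \<times> ?B"])
      (auto simp: prod_charts_inv[OF c d] open_Times open_chart_image c d chart_inv_map chart_dom_self)
  then show ?thesis by (simp add: Pair has_tangent_map_def)
qed

lemma has_tangent_map_snd:
  assumes c: "charted c" and d: "charted d"
  shows "has_tangent_map (prod_charts c d) d snd p snd"
proof (cases p)
  case (Pair x y)
  let ?A = "chart_map c x ` chart_dom c x" and ?B = "chart_map d y ` chart_dom d y"
  have "(snd has_derivative snd) (at (chart_map c x x, chart_map d y y))"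
    by (rule bounded_linear_imp_has_derivative[OF bounded_linear_snd])
  then have "((chart_map d y \<circ> snd \<circ> chart_inv (prod_charts c d) (x, y)) has_derivative snd)
      (at (chart_map c x x, chart_map d y y))"
    by (rule has_derivative_transform_within_open[where s = "?A \<times> ?B"])
      (auto simp: prod_charts_inv[OF c d] open_Times open_chart_image c d chart_inv_map chart_dom_self)
  then show ?thesis by (simp add: Pair has_tangent_map_def)
qed

section \<open>Velocities of curves\<close>

lemma has_tangent_map_vec_iff:
  "has_tangent_map vec_charts vec_charts f x D \<longleftrightarrow> (f has_derivative D) (at x)"
  by (auto simp: has_tangent_map_def has_derivative_continuous)

text \<open>A velocity is a tangent map out of the real line, so the chain and pairing rules apply
  to curves.\<close>

lemma has_velocity_iff:
  fixes c :: "('m::t2_space, 'e::real_normed_vector) charts"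
  shows "has_velocity c \<gamma> v t \<longleftrightarrow> has_tangent_map vec_charts c \<gamma> t (\<lambda>s. s *\<^sub>R v)"
  by (simp add: has_velocity_def has_tangent_map_def has_vector_derivative_def o_def)

lemma has_velocity_unique:
  fixes c :: "('m::t2_space, 'e::real_normed_vector) charts"
  shows "has_velocity c \<gamma> v t \<Longrightarrow> has_velocity c \<gamma> w t \<Longrightarrow> v = w"
  unfolding has_velocity_def by (metis vector_derivative_at)

lemma has_velocity_compose:
  assumes c: "charted c" and \<gamma>: "has_velocity c \<gamma> v t" and f: "has_tangent_map c d f (\<gamma> t) D"
  shows "has_velocity d (\<lambda>s. f (\<gamma> s)) (D v) t"
  using has_tangent_map_compose[OF charted_vec c \<gamma>[unfolded has_velocity_iff] f]
  by (simp add: has_velocity_iff linear_cmul[OF bounded_linear.linear[OF has_tangent_map_linear[OF f]]])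

text \<open>With \<open>r = 1\<close> this translates time, as the addition laws require; with
  \<open>a = 0\<close> it rescales time, as the exponential map requires.\<close>

lemma has_velocity_scale:
  assumes c: "charted c" and \<gamma>: "has_velocity c \<gamma> v (r * t + a)"
  shows "has_velocity c (\<lambda>s. \<gamma> (r * s + a)) (r *\<^sub>R v) t"
proof -
  have "((\<lambda>s. r * s + a) has_derivative (\<lambda>s. r * s)) (at t)" by (auto intro!: derivative_eq_intros)
  then have "has_tangent_map vec_charts vec_charts (\<lambda>s. r * s + a) t (\<lambda>s. r * s)"
    by (simp add: has_tangent_map_vec_iff)
  from has_tangent_map_compose[OF charted_vec charted_vec this \<gamma>[unfolded has_velocity_iff]]
  show ?thesis by (simp add: has_velocity_iff mult.commute)
qed

lemma has_velocity_transform: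
  fixes c :: "('m::t2_space, 'e::real_normed_vector) charts"
  assumes "open U" "t \<in> U" "\<And>s. s \<in> U \<Longrightarrow> \<gamma> s = \<delta> s" "has_velocity c \<gamma> v t"
  shows "has_velocity c \<delta> v t"
  using assms has_tangent_map_transform[OF charted_vec assms(1,2), of \<gamma> \<delta>]
  by (simp add: has_velocity_iff)

lemma has_velocity_Pair_iff:
  assumes c: "charted c" and d: "charted d"
  shows "has_velocity (prod_charts c d) (\<lambda>t. (\<gamma> t, \<delta> t)) (v, w) t \<longleftrightarrow>
    has_velocity c \<gamma> v t \<and> has_velocity d \<delta> w t"
proof
  assume h: "has_velocity (prod_charts c d) (\<lambda>t. (\<gamma> t, \<delta> t)) (v, w) t"
  show "has_velocity c \<gamma> v t \<and> has_velocity d \<delta> w t"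
    using has_velocity_compose[OF charted_prod[OF c d] h has_tangent_map_fst[OF c d]]
      has_velocity_compose[OF charted_prod[OF c d] h has_tangent_map_snd[OF c d]] by simp
next
  assume h: "has_velocity c \<gamma> v t \<and> has_velocity d \<delta> w t"
  then show "has_velocity (prod_charts c d) (\<lambda>t. (\<gamma> t, \<delta> t)) (v, w) t"
    using has_tangent_map_Pair[of vec_charts c \<gamma> t "\<lambda>s. s *\<^sub>R v" d \<delta> "\<lambda>s. s *\<^sub>R w"]
    by (simp add: has_velocity_iff)
qed

lemma has_velocity_vec_iff: "has_velocity vec_charts \<gamma> v t \<longleftrightarrow> (\<gamma> has_vector_derivative v) (at t)"
  by (auto simp: has_velocity_def has_vector_derivative_continuous)

section \<open>Tangent maps of smooth maps and of charts\<close>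

lemma smooth_map_open:
  assumes c: "charted c" and d: "charted d" and f: "smooth_map c d f"
  shows "open (chart_map c x ` (chart_dom c x \<inter> f -` chart_dom d y))"
proof (rule open_chart_map_image[OF c])
  show "open (chart_dom c x \<inter> f -` chart_dom d y)"
    using f by (auto simp: smooth_map_def intro!: open_Int open_vimage open_chart_dom c d)
qed simp

lemma smooth_map_has_tangent_map:
  assumes c: "charted c" and d: "charted d" and f: "smooth_map c d f"
  shows "has_tangent_map c d f x (tangent_map c d f x)"
proof -
  have "smooth_on (chart_map c x ` (chart_dom c x \<inter> f -` chart_dom d (f x)))
      (chart_map d (f x) \<circ> f \<circ> chart_inv c x)"
    using f by (simp add: smooth_map_def)
  then have "((chart_map d (f x) \<circ> f \<circ> chart_inv c x) has_derivative
      frechet_derivative (chart_map d (f x) \<circ> f \<circ> chart_inv c x) (at (chart_map c x x)))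
      (at (chart_map c x x))"
    by (rule smooth_on_has_derivative)
      (use chart_dom_self[OF d] chart_dom_self[OF c] in auto)
  moreover have "isCont f x"
    using f by (simp add: smooth_map_def continuous_on_eq_continuous_at)
  ultimately show ?thesis by (simp add: has_tangent_map_def tangent_map_def)
qed

context
  fixes c :: "('m::t2_space, 'e::real_normed_vector) charts"
  assumes c: "smooth_structure c"
begin

text \<open>In components at \<open>y\<close>, the chart at \<open>x\<close> is a transition map.
  Compatibility of charts enters here and in the next lemma.\<close>

lemma chart_map_has_tangent_map:
  assumes y: "y \<in> chart_dom c x"
  shows "has_tangent_map c vec_charts (chart_map c x) y (tangent_map c vec_charts (chart_map c x) y)"
proof -
  have "smooth_on (chart_map c y ` (chart_dom c y \<inter> chart_dom c x)) (chart_map c x \<circ> chart_inv c y)"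
    using c by (simp add: smooth_structure_def)
  then have "((chart_map c x \<circ> chart_inv c y) has_derivative
      frechet_derivative (chart_map c x \<circ> chart_inv c y) (at (chart_map c y y))) (at (chart_map c y y))"
    by (rule smooth_on_has_derivative)
      (use y chart_dom_self[OF smooth_structure_charted[OF c]] in auto)
  then show ?thesis
    using isCont_chart_map[OF smooth_structure_charted[OF c] y]
    by (simp add: has_tangent_map_def tangent_map_def)
qed

lemma chart_inv_has_tangent_map:
  assumes a: "a \<in> chart_map c x ` chart_dom c x"
  shows "has_tangent_map vec_charts c (chart_inv c x) a (tangent_map vec_charts c (chart_inv c x) a)"
proof -
  let ?y = "chart_inv c x a"
  note ch = smooth_structure_charted[OF c]
  have "smooth_on (chart_map c x ` (chart_dom c x \<inter> chart_dom c ?y)) (chart_map c ?y \<circ> chart_inv c x)"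
    using c by (simp add: smooth_structure_def)
  then have "((chart_map c ?y \<circ> chart_inv c x) has_derivative
      frechet_derivative (chart_map c ?y \<circ> chart_inv c x) (at a)) (at a)"
    by (rule smooth_on_has_derivative)
      (rule image_eqI[of _ _ ?y],
        simp_all add: chart_map_inv[OF ch a] chart_inv_dom[OF ch a] chart_dom_self[OF ch])
  then show ?thesis
    using isCont_chart_inv[OF ch a] by (simp add: has_tangent_map_def tangent_map_def)
qed

text \<open>Components in the preferred chart at \<open>y\<close> are converted to the chart at
  \<open>x\<close> and back; the composite is the differential of the identity near
  \<open>y\<close>.\<close>

lemma tangent_chart_inv_map:
  assumes y: "y \<in> chart_dom c x"
  shows "tangent_map vec_charts c (chart_inv c x) (chart_map c x y)
    (tangent_map c vec_charts (chart_map c x) y v) = v"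
proof -
  note ch = smooth_structure_charted[OF c]
  have "has_tangent_map c c (\<lambda>z. chart_inv c x (chart_map c x z)) y
    (\<lambda>v. tangent_map vec_charts c (chart_inv c x) (chart_map c x y)
      (tangent_map c vec_charts (chart_map c x) y v))"
    by (rule has_tangent_map_compose[OF ch charted_vec chart_map_has_tangent_map[OF y]
        chart_inv_has_tangent_map[OF imageI[OF y]]])
  from has_tangent_map_transform[OF ch open_chart_dom[OF ch] y _ this, of "\<lambda>z. z"]
  have "has_tangent_map c c (\<lambda>z. z) y
    (\<lambda>v. tangent_map vec_charts c (chart_inv c x) (chart_map c x y)
      (tangent_map c vec_charts (chart_map c x) y v))"
    by (simp add: chart_inv_map[OF ch])
  from has_tangent_map_unique[OF this has_tangent_map_ident[OF ch]] show ?thesis by meson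
qed

end

section \<open>Ordinary differential equations\<close>

text \<open>The mean value inequality, standing in for the norm estimate of an integral.\<close>

lemma vector_antiderivative_bound:
  fixes g :: "real \<Rightarrow> 'a::real_normed_vector"
  assumes g: "\<And>t. t \<in> S \<Longrightarrow> (g has_vector_derivative g' t) (at t within S)" and S: "convex S"
    and B: "\<And>t. t \<in> S \<Longrightarrow> norm (g' t) \<le> B" and st: "s \<in> S" "t \<in> S"
  shows "norm (g t - g s) \<le> B * \<bar>t - s\<bar>"
proof -
  have "norm (g t - g s) \<le> B * norm (t - s)"
  proof (rule differentiable_bound[OF S _ _ st(2) st(1)])
    show "(g has_derivative (\<lambda>h. h *\<^sub>R g' t)) (at t within S)" if "t \<in> S" for t
      using g[OF that] by (simp add: has_vector_derivative_def)
    show "onorm (\<lambda>h. h *\<^sub>R g' t) \<le> B" if "t \<in> S" for t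
      using B[OF that] mult_left_mono[OF B[OF that] abs_ge_zero]
      by (intro onorm_bound) (auto simp: mult.commute intro: order_trans[OF norm_ge_zero])
  qed
  then show ?thesis by simp
qed

text \<open>Integration is componentwise because the model space of a Lie group is not of class \<open>banach\<close>.\<close>

lemma frame_antiderivative:
  fixes f :: "real \<Rightarrow> 'a::real_normed_vector" and b :: "'i \<Rightarrow> 'a"
  assumes F: "frame I \<phi> b" and f: "continuous_on {p..q} f"
  shows "\<exists>g. \<forall>t\<in>{p..q}. (g has_vector_derivative f t) (at t within {p..q})"
proof -
  have "\<exists>g. \<forall>t\<in>{p..q}. (g has_vector_derivative \<phi> i (f t)) (at t within {p..q})" for i
    by (rule antiderivative_continuous[OF bounded_linear.continuous_on[OF frame_bounded_linear[OF F] f]])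
      blast
  then obtain g where g: "\<And>i t. t \<in> {p..q} \<Longrightarrow>
      (g i has_vector_derivative \<phi> i (f t)) (at t within {p..q})" by metis
  have "((\<lambda>t. \<Sum>i\<in>I. g i t *\<^sub>R b i) has_vector_derivative f t) (at t within {p..q})"
    if "t \<in> {p..q}" for t
  proof -
    have "((\<lambda>t. \<Sum>i\<in>I. g i t *\<^sub>R b i) has_vector_derivative (\<Sum>i\<in>I. \<phi> i (f t) *\<^sub>R b i))
        (at t within {p..q})"
      by (intro has_vector_derivative_sum bounded_linear.has_vector_derivative[OF bounded_linear_scaleR_left]
          g that)
    then show ?thesis by (simp only: frame_expand[OF F])
  qed
  then show ?thesis by blast
qed

text \<open>Each of the finitely many functions Df(y)(b i) is continuous in \<open>y\<close>, hence
  bounded near \<open>x\<close>. The frame turns these bounds into one on the operator norm, and the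
  ball is convex.\<close>

lemma frame_locally_Lipschitz:
  fixes f :: "'a::real_normed_vector \<Rightarrow> 'b::real_normed_vector" and b :: "'i \<Rightarrow> 'a"
  assumes F: "frame I \<phi> b" and V: "open V" "x \<in> V" and f: "smooth_on V f"
  obtains r L where "r > 0" "L > 0" "cball x r \<subseteq> V"
    "\<And>y z. y \<in> cball x r \<Longrightarrow> z \<in> cball x r \<Longrightarrow> norm (f y - f z) \<le> L * norm (y - z)"
proof -
  let ?D = "\<lambda>y. frechet_derivative f (at y)"
  have "\<exists>e>0. \<forall>y\<in>ball x e. norm (?D y (b i)) \<le> norm (?D x (b i)) + 1" for i
  proof -
    have "isCont (\<lambda>y. norm (?D y (b i))) x"
      using smooth_on_continuous[OF smooth_on_derivative[OF f]] V
      by (auto simp: continuous_on_eq_continuous_at intro!: continuous_norm)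
    then obtain e where "e > 0"
        "\<And>y. dist y x < e \<Longrightarrow> dist (norm (?D y (b i))) (norm (?D x (b i))) < 1"
      unfolding continuous_at_eps_delta dist_norm[symmetric] by (metis zero_less_one)
    then show ?thesis
      by (intro exI[of _ e]) (force simp: dist_real_def dist_commute)
  qed
  then obtain e where e: "\<And>i. e i > 0"
      "\<And>i y. y \<in> ball x (e i) \<Longrightarrow> norm (?D y (b i)) \<le> norm (?D x (b i)) + 1"
    by metis
  obtain K where K: "\<And>i v. norm (\<phi> i v) \<le> norm v * K i"
    using bounded_linear.bounded[OF frame_bounded_linear[OF F]] by metis
  have K0: "0 \<le> norm v * K i" for v :: 'a and i by (rule order_trans[OF norm_ge_zero K])
  obtain s where s: "s > 0" "cball x s \<subseteq> V" using V open_contains_cball by metis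
  \<comment> \<open>Half the minimum, so that the closed ball of radius \<open>r\<close> lies inside
    each open ball of radius \<open>e i\<close>.\<close>
  define r where "r = Min (insert s (e ` I)) / 2"
  \<comment> \<open>The summand 1 keeps \<open>L\<close> positive even for an empty frame; the
    Picard iteration divides by \<open>L\<close>.\<close>
  define L where "L = 1 + \<bar>\<Sum>i\<in>I. K i * (norm (?D x (b i)) + 1)\<bar>"
  have fin: "finite I" by (rule frame_finite[OF F])
  have r: "r > 0" "r \<le> s"  "\<And>i. i \<in> I \<Longrightarrow> r < e i"
  proof -
    have m: "Min (insert s (e ` I)) > 0" using fin s e by (subst Min_gr_iff) auto
    moreover have "Min (insert s (e ` I)) \<le> s" using fin by (intro Min_le) auto
    moreover have "Min (insert s (e ` I)) \<le> e i" if "i \<in> I" for i using fin that by (intro Min_le) auto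
    ultimately show "r > 0" "r \<le> s"  "\<And>i. i \<in> I \<Longrightarrow> r < e i" unfolding r_def by (force, linarith, force)
  qed
  show thesis
  proof (rule that[of r L])
    show "r > 0" "L > 0" "cball x r \<subseteq> V" using r s by (auto simp: L_def)
    fix y z assume yz: "y \<in> cball x r" "z \<in> cball x r"
    show "norm (f y - f z) \<le> L * norm (y - z)"
    proof (rule differentiable_bound[OF convex_cball _ _ yz(1,2)])
      fix w assume w: "w \<in> cball x r"
      have d: "(f has_derivative ?D w) (at w)"
        using w r(2) s(2) by (intro smooth_on_has_derivative[OF f]) auto
      then show "(f has_derivative ?D w) (at w within cball x r)"
        by (rule has_derivative_at_withinI)
      show "onorm (?D w) \<le> L"
      proof (rule onorm_bound)
        fix v
        have "?D w v = (\<Sum>i\<in>I. \<phi> i v *\<^sub>R ?D w (b i))"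
          by (rule linear_frame_expand[OF F has_derivative_linear[OF d]])
        also have "norm \<dots> \<le> (\<Sum>i\<in>I. (norm v * K i) * (norm (?D x (b i)) + 1))"
        proof (rule sum_norm_le)
          fix i assume i: "i \<in> I"
          have "w \<in> ball x (e i)" using w r(3)[OF i] by auto
          then show "norm (\<phi> i v *\<^sub>R ?D w (b i)) \<le> (norm v * K i) * (norm (?D x (b i)) + 1)"
            using mult_mono[OF K e(2) K0 norm_ge_zero] by simp
        qed
        also have "\<dots> = (\<Sum>i\<in>I. K i * (norm (?D x (b i)) + 1)) * norm v"
          unfolding sum_distrib_right by (intro sum.cong) (auto simp: mult_ac)
        also have "\<dots> \<le> L * norm v" by (intro mult_right_mono) (auto simp: L_def)
        finally show "norm (?D w v) \<le> L * norm v" .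
      qed (simp add: L_def)
    qed
  qed
qed

text \<open>Picard-Lindeloef through Banach's fixed point theorem, for curves with values in a
  closed ball around \<open>x\<close>.\<close>

lemma Picard:
  fixes f :: "'a::{real_normed_vector, complete_space} \<Rightarrow> 'a" and b :: "'i \<Rightarrow> 'a"
  assumes F: "frame I \<phi> b" and V: "open V" "x \<in> V" and f: "smooth_on V f"
  shows "\<exists>e>0. \<exists>y. y 0 = x \<and>
    (\<forall>t\<in>{- e<..<e}. y t \<in> V \<and> (y has_vector_derivative f (y t)) (at t))"
proof -
  obtain r L where r: "r > 0" "L > 0" "cball x r \<subseteq> V"
    and L: "\<And>y z. y \<in> cball x r \<Longrightarrow> z \<in> cball x r \<Longrightarrow> norm (f y - f z) \<le> L * norm (y - z)"
    using frame_locally_Lipschitz[OF F V f] by blast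
  \<comment> \<open>A bound for \<open>f\<close> on the ball by the Lipschitz estimate; the summand
    1 makes it positive, to be divided by.\<close>
  define M where "M = norm (f x) + L * r + 1"
  have M: "M > 0" using r by (auto simp: M_def intro: add_nonneg_pos)
  have fM: "norm (f y) \<le> M" if y: "y \<in> cball x r" for y
  proof -
    have "norm (f y - f x) \<le> L * r"
    proof -
      have "norm (y - x) \<le> r" using y by (simp add: dist_norm norm_minus_commute)
      then have "L * norm (y - x) \<le> L * r" using r(2) by simp
      moreover have "norm (f y - f x) \<le> L * norm (y - x)" using L[OF y, of x] r(1) by simp
      ultimately show ?thesis by (rule order_trans[rotated])
    qed
    then show ?thesis using norm_triangle_sub[of "f y" "f x"] by (auto simp: M_def)
  qed
  \<comment> \<open>The first bound keeps the iterates within distance \<open>r\<close> of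
    \<open>x\<close>, the second makes the iteration a contraction with factor 1/2.\<close>
  define e where "e = min (r / M) (1 / (2 * L))"
  have e: "e > 0" "M * e \<le> r" "L * e \<le> 1 / 2"
  proof -
    show "e > 0" using r M by (simp add: e_def)
    have "e \<le> r / M" "e \<le> 1 / (2 * L)" by (auto simp: e_def)
    then show "M * e \<le> r" "L * e \<le> 1 / 2" using M r by (auto simp: field_simps)
  qed
  have fc: "continuous_on (cball x r) f"
    using smooth_on_continuous[OF f] r(3) by (rule continuous_on_subset)
  define S :: "(real \<Rightarrow>\<^sub>C 'a) set" where "S = PiC UNIV (\<lambda>t. cball x r)"
  have S: "u \<in> S \<longleftrightarrow> (\<forall>t. apply_bcontfun u t \<in> cball x r)" for u
    by (auto simp: S_def mem_PiC_iff)
  \<comment> \<open>A chosen antiderivative. Only differences of its values are used, so the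
    constant of integration does not matter.\<close>
  define G where "G u = (SOME g. \<forall>t\<in>{- e..e}. (g has_vector_derivative f (apply_bcontfun u t))
    (at t within {- e..e}))" for u :: "real \<Rightarrow>\<^sub>C 'a"
  have G: "(G u has_vector_derivative f (apply_bcontfun u t)) (at t within {- e..e})"
    if "u \<in> S" "t \<in> {- e..e}" for u t
  proof -
    have "continuous_on {- e..e} (\<lambda>t. f (apply_bcontfun u t))"
      using that(1) by (intro continuous_on_compose2[OF fc continuous_on_apply_bcontfun]) (auto simp: S)
    from someI_ex[OF frame_antiderivative[OF F this]] show ?thesis
      unfolding G_def using that(2) by blast
  qed
  \<comment> \<open>Bounded continuous functions live on the whole line; clamping the time to
    [-e, e] extends the iterates constantly beyond it.\<close>
  define cl where "cl t = max (- e) (min e t)" for t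
  have cl: "cl t \<in> {- e..e}" "0 \<in> {- e..e}" "\<bar>cl t\<bar> \<le> e" for t using e by (auto simp: cl_def)
  define P where "P u = Bcontfun (\<lambda>t. x + (G u (cl t) - G u 0))" for u
  have Gb: "norm (G u (cl t) - G u 0) \<le> r" if u: "u \<in> S" for u t
  proof -
    have "norm (G u (cl t) - G u 0) \<le> M * \<bar>cl t - 0\<bar>"
      by (rule vector_antiderivative_bound[OF G[OF u] _ fM]) (use cl u S in auto)
    also have "\<dots> \<le> M * e" using M cl by simp
    finally show ?thesis using e by simp
  qed
  have P: "apply_bcontfun (P u) t = x + (G u (cl t) - G u 0)" if u: "u \<in> S" for u t
  proof -
    have "continuous_on {- e..e} (G u)"
      using G[OF u] has_vector_derivative_continuous continuous_on_eq_continuous_within by blast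
    then have "continuous_on UNIV (\<lambda>t. G u (cl t))"
      by (rule continuous_on_compose2) (use cl in \<open>auto simp: cl_def intro!: continuous_intros\<close>)
    then have "continuous_on UNIV (\<lambda>t. x + (G u (cl t) - G u 0))"
      by (intro continuous_intros)
    moreover have "bounded (range (\<lambda>t. x + (G u (cl t) - G u 0)))"
      using Gb[OF u] by (intro bounded_subset[OF bounded_cball[of x r]]) (auto simp: dist_norm norm_minus_commute)
    ultimately have "(\<lambda>t. x + (G u (cl t) - G u 0)) \<in> bcontfun"
      by (simp add: bcontfun_def)
    then show ?thesis by (simp add: P_def Bcontfun_inverse)
  qed
  have "\<exists>!u\<in>S. P u = u"
  proof (rule Banach_fix[where c = "1 / 2"])
    show "complete S" unfolding S_def complete_eq_closed by (rule closed_PiC) auto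
    have "const_bcontfun x \<in> S" using r by (auto simp: S)
    then show "S \<noteq> {}" by auto
    show "P ` S \<subseteq> S"
      using Gb by (auto simp: S[of "P _"] P dist_norm norm_minus_commute[of "G _ 0"])
    fix u v assume uv: "u \<in> S" "v \<in> S"
    show "dist (P u) (P v) \<le> 1 / 2 * dist u v"
    proof (rule dist_bound)
      fix t
      have "norm ((G u (cl t) - G v (cl t)) - (G u 0 - G v 0)) \<le> (L * dist u v) * \<bar>cl t - 0\<bar>"
      proof (rule vector_antiderivative_bound)
        show "((\<lambda>t. G u t - G v t) has_vector_derivative
            f (apply_bcontfun u t) - f (apply_bcontfun v t)) (at t within {- e..e})"
          if "t \<in> {- e..e}" for t
          using G[OF uv(1) that] G[OF uv(2) that] by (rule has_vector_derivative_diff)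
        show "norm (f (apply_bcontfun u t) - f (apply_bcontfun v t)) \<le> L * dist u v" for t
        proof -
          have "norm (f (apply_bcontfun u t) - f (apply_bcontfun v t))
              \<le> L * dist (apply_bcontfun u t) (apply_bcontfun v t)"
            using uv L by (auto simp: S dist_norm)
          also have "\<dots> \<le> L * dist u v" using r dist_bounded by (intro mult_left_mono) auto
          finally show ?thesis .
        qed
      qed (use cl in auto)
      also have "\<dots> \<le> (L * dist u v) * e" using r cl by (intro mult_left_mono) auto
      also have "\<dots> = (L * e) * dist u v" by simp
      also have "\<dots> \<le> 1 / 2 * dist u v" using e by (intro mult_right_mono) auto
      finally show "dist (apply_bcontfun (P u) t) (apply_bcontfun (P v) t) \<le> 1 / 2 * dist u v"
        using uv by (simp add: P dist_norm algebra_simps)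
    qed
  qed auto
  then obtain u where u: "u \<in> S" "P u = u" by blast
  let ?y = "apply_bcontfun u"
  have y: "?y t = x + (G u (cl t) - G u 0)" for t using P[OF u(1)] u(2) by simp
  have "?y t \<in> V \<and> (?y has_vector_derivative f (?y t)) (at t)" if t: "t \<in> {- e<..<e}" for t
  proof
    show "?y t \<in> V" using u S r by blast
    have "(G u has_vector_derivative f (?y t)) (at t within {- e<..<e})"
      using G[OF u(1), of t] t by (auto intro: has_vector_derivative_within_subset)
    then have "(G u has_vector_derivative f (?y t)) (at t)"
      using t by (simp add: at_within_open[OF t])
    then have "((\<lambda>t. x + (G u t - G u 0)) has_vector_derivative f (?y t)) (at t)"
      by (auto intro!: derivative_eq_intros)
    then show "(?y has_vector_derivative f (?y t)) (at t)"
      by (rule has_vector_derivative_transform_within_open[OF _ open_greaterThanLessThan t])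
        (auto simp: y cl_def)
  qed
  moreover have "?y 0 = x" using e by (simp add: y cl_def)
  ultimately show ?thesis using e(1) by blast
qed

text \<open>Near each time the curve stays in one chart and its coordinates have derivative zero.
  Injectivity of the chart gives local constancy, connectedness does the rest.\<close>

lemma zero_velocity_constant:
  fixes c :: "('m::t2_space, 'e::real_normed_vector) charts"
  assumes c: "smooth_structure c" and I: "open I" "connected I" "s \<in> I" "t \<in> I"
    and \<gamma>: "\<And>t. t \<in> I \<Longrightarrow> has_velocity c \<gamma> 0 t"
  shows "\<gamma> s = \<gamma> t"
proof (rule connected_local_const[OF I(2-4)], rule ballI)
  note ch = smooth_structure_charted[OF c]
  fix t assume t: "t \<in> I"
  let ?D = "chart_dom c (\<gamma> t)" and ?\<phi> = "chart_map c (\<gamma> t)"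
  have "isCont \<gamma> t" using \<gamma>[OF t] by (simp add: has_velocity_def)
  then obtain U where U: "open U" "t \<in> U" "\<And>s. s \<in> U \<Longrightarrow> \<gamma> s \<in> ?D"
    using open_chart_dom[OF ch] chart_dom_self[OF ch] unfolding continuous_at_open by meson
  obtain e where e: "e > 0" "ball t e \<subseteq> U \<inter> I"
    using open_contains_ball[THEN iffD1, OF open_Int[OF U(1) I(1)]] U(2) t by blast
  have "((\<lambda>s. ?\<phi> (\<gamma> s)) has_vector_derivative 0) (at s within ball t e)" if s: "s \<in> ball t e" for s
  proof -
    have sI: "s \<in> I" and sD: "\<gamma> s \<in> ?D" using s e U by auto
    have "has_velocity vec_charts (\<lambda>s. ?\<phi> (\<gamma> s)) (tangent_map c vec_charts ?\<phi> (\<gamma> s) 0) s"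
      by (rule has_velocity_compose[OF ch \<gamma>[OF sI] chart_map_has_tangent_map[OF c sD]])
    then show ?thesis
      using linear_0[OF bounded_linear.linear[OF has_tangent_map_linear[OF chart_map_has_tangent_map[OF c sD]]]]
      by (simp add: has_velocity_vec_iff has_vector_derivative_at_within)
  qed
  then obtain k where k: "\<And>s. s \<in> ball t e \<Longrightarrow> ?\<phi> (\<gamma> s) = k"
    using has_vector_derivative_zero_constant[OF convex_ball] by blast
  have "\<gamma> t = \<gamma> s" if s: "s \<in> ball t e" for s
  proof -
    have "?\<phi> (\<gamma> s) = ?\<phi> (\<gamma> t)" using k[OF s] k[of t] e(1) by simp
    moreover have "\<gamma> s \<in> ?D" "\<gamma> t \<in> ?D" using s e U by auto
    ultimately show ?thesis using chart_inv_map[OF ch] by metis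
  qed
  then show "eventually (\<lambda>s. \<gamma> t = \<gamma> s) (at t within I)"
    using e(1) unfolding eventually_at by (auto simp: dist_commute)
qed

section \<open>One-parameter subgroups and the Lie bracket\<close>

context lie_group
begin

section \<open>Differentials of the group operations\<close>

abbreviation C where "C \<equiv> charts G"

lemma in_carrier [simp]: "x \<in> carrier G"
  by (simp add: carrier_UNIV)

lemma charted: "charted C" "charted (prod_charts C C)"
  using smooth_structure smooth_structure_charted charted_prod by blast+

text \<open>On \<open>(v, 0)\<close> this is the differential at \<open>g\<close> of right
  translation by \<open>h\<close>, on \<open>(0, w)\<close> the differential at \<open>h\<close> of
  left translation by \<open>g\<close>.\<close>

definition mult_tangent :: "'g \<Rightarrow> 'g \<Rightarrow> 'e \<times> 'e \<Rightarrow> 'e" where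
  "mult_tangent g h = tangent_map (prod_charts C C) C (\<lambda>(g, h). g \<otimes> h) (g, h)"

lemma mult_has_tangent_map:
  "has_tangent_map (prod_charts C C) C (\<lambda>(g, h). g \<otimes> h) (g, h) (mult_tangent g h)"
  unfolding mult_tangent_def
  by (rule smooth_map_has_tangent_map[OF charted(2,1) smooth_mult])

lemma mult_tangent_linear: "linear (mult_tangent g h)"
  by (rule bounded_linear.linear[OF has_tangent_map_linear[OF mult_has_tangent_map]])

lemma has_tangent_map_mult:
  assumes f: "has_tangent_map d C f x D" and k: "has_tangent_map d C k x E" and d: "charted d"
  shows "has_tangent_map d C (\<lambda>y. f y \<otimes> k y) x (\<lambda>v. mult_tangent (f x) (k x) (D v, E v))"
  using has_tangent_map_compose[OF d charted(2) has_tangent_map_Pair[OF f k] mult_has_tangent_map]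
  by simp

lemma has_velocity_mult:
  assumes "has_velocity C \<gamma> v t" "has_velocity C \<delta> w t"
  shows "has_velocity C (\<lambda>t. \<gamma> t \<otimes> \<delta> t) (mult_tangent (\<gamma> t) (\<delta> t) (v, w)) t"
  using has_tangent_map_mult[OF assms[unfolded has_velocity_iff] charted_vec]
    linear_cmul[OF mult_tangent_linear, of "\<gamma> t" "\<delta> t" _ "(v, w)"]
  by (simp add: has_velocity_iff)

lemma has_tangent_map_right_mult:
  "has_tangent_map C C (\<lambda>h. h \<otimes> g) h (\<lambda>v. mult_tangent h g (v, 0))"
  by (rule has_tangent_map_mult[OF has_tangent_map_ident[OF charted(1)] has_tangent_map_const charted(1)])

lemma has_tangent_map_left_mult:
  "has_tangent_map C C (\<lambda>h. g \<otimes> h) h (\<lambda>v. mult_tangent g h (0, v))"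
  by (rule has_tangent_map_mult[OF has_tangent_map_const has_tangent_map_ident[OF charted(1)] charted(1)])

lemma TR_eq: "TR G g v = mult_tangent \<one> g (v, 0)"
  unfolding TR_def has_tangent_map_eq[OF has_tangent_map_right_mult] by simp

lemma TR_has_tangent_map: "has_tangent_map C C (\<lambda>h. h \<otimes> g) \<one> (TR G g)"
  using has_tangent_map_right_mult[of g \<one>] by (simp add: TR_eq[abs_def])

lemma TR_bounded_linear: "bounded_linear (TR G g)"
  using has_tangent_map_linear[OF TR_has_tangent_map] .

text \<open>Right invariance of the field generated by \<open>v\<close>: differentiate the
  associative law (k h) g = k (h g) at k = 1.\<close>

lemma mult_tangent_TR: "mult_tangent h g (TR G h v, 0) = TR G (h \<otimes> g) v"
proof -
  have "has_tangent_map C C (\<lambda>k. (k \<otimes> h) \<otimes> g) \<one> (\<lambda>v. mult_tangent h g (TR G h v, 0))"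
    using has_tangent_map_compose[OF charted(1,1) TR_has_tangent_map has_tangent_map_right_mult, of h g]
    by simp
  then have "has_tangent_map C C (\<lambda>k. k \<otimes> (h \<otimes> g)) \<one> (\<lambda>v. mult_tangent h g (TR G h v, 0))"
    by (simp add: m_assoc)
  from has_tangent_map_unique[OF this TR_has_tangent_map] show ?thesis by metis
qed

lemma TR_one: "TR G \<one> v = v"
proof -
  have "has_tangent_map C C (\<lambda>k. k) \<one> (TR G \<one>)" using TR_has_tangent_map[of \<one>] by simp
  from has_tangent_map_unique[OF this has_tangent_map_ident[OF charted(1)]] show ?thesis by metis
qed

lemma TR_bij: "bij (TR G g)"
proof (rule bij_betw_byWitness[where f' = "\<lambda>v. mult_tangent g (inv g) (v, 0)"])
  show "\<forall>v\<in>UNIV. mult_tangent g (inv g) (TR G g v, 0) = v" by (simp add: mult_tangent_TR TR_one)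
  have "mult_tangent \<one> g (mult_tangent g (inv g) (v, 0), 0) = v" for v
  proof -
    have "has_tangent_map C C (\<lambda>h. (h \<otimes> inv g) \<otimes> g) g
        (\<lambda>v. mult_tangent \<one> g (mult_tangent g (inv g) (v, 0), 0))"
      using has_tangent_map_compose[OF charted(1,1) has_tangent_map_right_mult has_tangent_map_right_mult,
          of "inv g" g g] by simp
    then have "has_tangent_map C C (\<lambda>h. h) g (\<lambda>v. mult_tangent \<one> g (mult_tangent g (inv g) (v, 0), 0))"
      by (simp add: m_assoc)
    from has_tangent_map_unique[OF this has_tangent_map_ident[OF charted(1)]] show ?thesis by metis
  qed
  then show "\<forall>v\<in>UNIV. TR G g (mult_tangent g (inv g) (v, 0)) = v" by (simp add: TR_eq)
qed auto

text \<open>Left translations have injective differentials, which isolates the velocity of the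
  second factor of a product of curves.\<close>

lemma mult_tangent_left_inverse: "mult_tangent (inv g) (g \<otimes> h) (0, mult_tangent g h (0, v)) = v"
proof -
  have "has_tangent_map C C (\<lambda>k. inv g \<otimes> (g \<otimes> k)) h
      (\<lambda>v. mult_tangent (inv g) (g \<otimes> h) (0, mult_tangent g h (0, v)))"
    by (rule has_tangent_map_compose[OF charted(1,1) has_tangent_map_left_mult has_tangent_map_left_mult])
  then have "has_tangent_map C C (\<lambda>k. k) h
      (\<lambda>v. mult_tangent (inv g) (g \<otimes> h) (0, mult_tangent g h (0, v)))"
    by (simp add: m_assoc[symmetric])
  from has_tangent_map_unique[OF this has_tangent_map_ident[OF charted(1)]] show ?thesis by metis
qed

text \<open>The quotient \<open>inv \<gamma> \<otimes> \<delta>\<close> has velocity zero.\<close>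

lemma integral_curve_unique:
  assumes I: "open I" "connected I" "s \<in> I" "t \<in> I"
    and \<gamma>: "integral_curve C (\<lambda>g. TR G g \<xi>) I \<gamma>" and \<delta>: "integral_curve C (\<lambda>g. TR G g \<xi>) I \<delta>"
    and eq: "\<gamma> s = \<delta> s"
  shows "\<gamma> t = \<delta> t"
proof -
  define q where "q t = inv (\<gamma> t) \<otimes> \<delta> t" for t
  have "has_velocity C q 0 t" if t: "t \<in> I" for t
  proof -
    have vel: "has_velocity C \<gamma> (TR G (\<gamma> t) \<xi>) t" "has_velocity C \<delta> (TR G (\<delta> t) \<xi>) t"
      using \<gamma> \<delta> t by (auto simp: integral_curve_def)
    have "has_tangent_map C C (\<lambda>g. inv g) (\<gamma> t) (tangent_map C C (\<lambda>g. inv g) (\<gamma> t))"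
      by (rule smooth_map_has_tangent_map[OF charted(1,1) smooth_inv])
    from has_velocity_mult[OF has_velocity_compose[OF charted(1) vel(1) this] vel(2)]
    obtain w where w: "has_velocity C q w t" unfolding q_def by blast
    have q: "\<gamma> t \<otimes> q t = \<delta> t" for t by (simp add: q_def m_assoc[symmetric])
    \<comment> \<open>The product rule for \<delta> = \<gamma> q. By right invariance the
      contribution of \<gamma> alone is already the full velocity of \<delta>, so the left translate
      of \<open>w\<close> is zero.\<close>
    have "has_velocity C \<delta> (mult_tangent (\<gamma> t) (q t) (TR G (\<gamma> t) \<xi>, w)) t"
      using has_velocity_mult[OF vel(1) w] by (simp add: q)
    then have "TR G (\<delta> t) \<xi> = mult_tangent (\<gamma> t) (q t) (TR G (\<gamma> t) \<xi>, w)"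
      by (rule has_velocity_unique[OF vel(2)])
    also have "\<dots> = mult_tangent (\<gamma> t) (q t) (TR G (\<gamma> t) \<xi>, 0) + mult_tangent (\<gamma> t) (q t) (0, w)"
      by (simp add: linear_add[OF mult_tangent_linear, symmetric])
    finally have "mult_tangent (\<gamma> t) (q t) (0, w) = 0"
      by (simp add: mult_tangent_TR q)
    then have "w = mult_tangent (inv \<gamma> t) (\<gamma> t \<otimes> q t) (0, 0)"
      using mult_tangent_left_inverse[of "\<gamma> t" "q t" w] by simp
    then have "w = 0" using linear_0[OF mult_tangent_linear] by (simp add: zero_prod_def)
    then show ?thesis using w by simp
  qed
  from zero_velocity_constant[OF smooth_structure I this] have "q s = q t" .
  then have "inv (\<gamma> t) \<otimes> \<delta> t = \<one>" by (simp add: q_def eq)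
  then show ?thesis by (metis in_carrier inv_closed inv_equality inv_inv)
qed

section \<open>Right invariant fields in a fixed chart and their integral curves\<close>

lemma frame_ex: "\<exists>(B :: 'e set) \<phi>. frame B \<phi> (\<lambda>b. b)"
  by (rule frame_exists[OF finite_dim])

text \<open>The right invariant field of \<open>\<eta>\<close> in the chart at \<open>x\<close>, as
  a function of the coordinates \<open>a\<close>. Unlike \<open>TR G g \<eta>\<close>, it does not
  refer to a chart that moves with the point.\<close>

definition right_field :: "'g \<Rightarrow> 'e \<Rightarrow> 'e \<Rightarrow> 'e" where
  "right_field x a \<eta> = tangent_map C vec_charts (chart_map C x) (chart_inv C x a)
     (TR G (chart_inv C x a) \<eta>)"

text \<open>The field is the partial derivative of multiplication in its first factor at the
  identity. With multiplication read in the charts at the identity and at \<open>x\<close>, joint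
  smoothness in point and generator follows.\<close>

lemma right_field_smooth:
  "smooth_on ((chart_map C x ` chart_dom C x) \<times> UNIV) (\<lambda>p. right_field x (fst p) (snd p))"
proof -
  let ?P = "prod_charts C C" and ?mult = "\<lambda>(g, h). g \<otimes> h" and ?A = "chart_map C x ` chart_dom C x"
  let ?B = "chart_map C \<one> ` chart_dom C \<one>" and ?o = "chart_map C \<one> \<one>"
  define \<psi> where "\<psi> = chart_map C x \<circ> ?mult \<circ> chart_inv ?P (\<one>, x)"
  define W where "W = chart_map ?P (\<one>, x) ` (chart_dom ?P (\<one>, x) \<inter> ?mult -` chart_dom C x)"
  have sm: "smooth_on W \<psi>"
    using smooth_mult unfolding smooth_map_def W_def \<psi>_def by blast
  have oA: "open ?A" and oB: "open ?B" by (simp_all add: open_chart_image[OF charted(1)])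
  have o: "?o \<in> ?B" using chart_dom_self[OF charted(1)] by blast
  have W: "(?o, a) \<in> W" if a: "a \<in> ?A" for a
  proof -
    obtain g where g: "g \<in> chart_dom C x" "a = chart_map C x g" using a by blast
    then show ?thesis unfolding W_def
      by (intro image_eqI[of _ _ "(\<one>, g)"]) (auto simp: chart_dom_self[OF charted(1)])
  qed
  \<comment> \<open>Both sides are the derivative, at the coordinates of the identity, of \<psi> in
    its first argument with \<open>a\<close> held fixed.\<close>
  have eq: "right_field x a \<eta> = frechet_derivative \<psi> (at (?o, a)) (\<eta>, 0)" if a: "a \<in> ?A" for a \<eta>
  proof -
    let ?g = "chart_inv C x a"
    have gD: "?g \<in> chart_dom C x" by (rule chart_inv_dom[OF charted(1) a])
    have "has_tangent_map C vec_charts (\<lambda>h. chart_map C x (h \<otimes> ?g)) \<one>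
        (\<lambda>\<eta>. tangent_map C vec_charts (chart_map C x) ?g (TR G ?g \<eta>))"
      using has_tangent_map_compose[OF charted(1,1) TR_has_tangent_map, of vec_charts "chart_map C x" ?g]
        chart_map_has_tangent_map[OF smooth_structure gD] by simp
    then have 1: "(((\<lambda>h. chart_map C x (h \<otimes> ?g)) \<circ> chart_inv C \<one>) has_derivative right_field x a) (at ?o)"
      by (simp add: has_tangent_map_def right_field_def[abs_def])
    have "((\<lambda>b. (b, a)) has_derivative (\<lambda>\<eta>. (\<eta>, 0))) (at ?o)"
      by (auto intro!: derivative_eq_intros)
    from has_derivative_compose[OF this smooth_on_has_derivative[OF sm W[OF a]]]
    have "((\<lambda>b. \<psi> (b, a)) has_derivative (\<lambda>\<eta>. frechet_derivative \<psi> (at (?o, a)) (\<eta>, 0))) (at ?o)" .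
    then have 2: "(((\<lambda>h. chart_map C x (h \<otimes> ?g)) \<circ> chart_inv C \<one>) has_derivative
        (\<lambda>\<eta>. frechet_derivative \<psi> (at (?o, a)) (\<eta>, 0))) (at ?o)"
      by (rule has_derivative_transform_within_open[OF _ oB o])
        (simp add: \<psi>_def prod_charts_inv[OF charted(1,1) _ a])
    from has_derivative_unique[OF 1 2] show ?thesis by metis
  qed
  obtain B :: "'e set" and \<phi> where F: "frame B \<phi> (\<lambda>b. b)" using frame_ex by blast
  let ?S = "?A \<times> (UNIV :: 'e set)"
  have oS: "open ?S" using oA by (simp add: open_Times)
  have "smooth_on ?S (\<lambda>p. frechet_derivative \<psi> (at (?o, fst p)) (snd p, 0))"
    by (rule smooth_on_derivative_apply[OF frame_Times[OF F F] oS
          smooth_on_Pair[OF oS smooth_on_const[OF oS] smooth_on_linear[OF bounded_linear_fst oS]] _ sm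
          smooth_on_Pair[OF oS smooth_on_linear[OF bounded_linear_snd oS] smooth_on_const[OF oS]]])
      (auto simp: W)
  moreover have "smooth_on ?S (\<lambda>p. right_field x (fst p) (snd p)) \<longleftrightarrow>
      smooth_on ?S (\<lambda>p. frechet_derivative \<psi> (at (?o, fst p)) (snd p, 0))"
    by (rule smooth_on_cong[OF oS]) (auto simp: eq)
  ultimately show ?thesis by (rule iffD2[rotated])
qed

text \<open>The equation is solved in the chart at the identity and carried back;
  \<open>tangent_chart_inv_map\<close> converts the velocity to the preferred charts along the
  curve.\<close>

lemma local_integral_curve:
  "\<exists>e>0. \<exists>\<gamma>. \<gamma> 0 = \<one> \<and> integral_curve C (\<lambda>g. TR G g \<xi>) {- e<..<e} \<gamma>"
proof -
  let ?A = "chart_map C \<one> ` chart_dom C \<one>" and ?o = "chart_map C \<one> \<one>"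
  obtain B :: "'e set" and \<phi> where F: "frame B \<phi> (\<lambda>b. b)" using frame_ex by blast
  have oA: "open ?A" by (rule open_chart_image[OF charted(1)])
  have o: "?o \<in> ?A" using chart_dom_self[OF charted(1)] by blast
  have "smooth_on ?A (\<lambda>a. right_field \<one> (fst (a, \<xi>)) (snd (a, \<xi>)))"
    by (rule smooth_on_compose[OF frame_Times[OF F F] oA _ _ right_field_smooth])
      (simp_all add: smooth_on_Pair[OF oA smooth_on_linear[OF bounded_linear_ident oA] smooth_on_const[OF oA]])
  then have "smooth_on ?A (\<lambda>a. right_field \<one> a \<xi>)" by simp
  from Picard[OF F oA o this] obtain e y where e: "e > 0" and y0: "y 0 = ?o"
    and y: "\<And>t. t \<in> {- e<..<e} \<Longrightarrow> y t \<in> ?A"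
    and y': "\<And>t. t \<in> {- e<..<e} \<Longrightarrow> (y has_vector_derivative right_field \<one> (y t) \<xi>) (at t)"
    by metis
  have "has_velocity C (\<lambda>t. chart_inv C \<one> (y t)) (TR G (chart_inv C \<one> (y t)) \<xi>) t"
    if t: "t \<in> {- e<..<e}" for t
  proof -
    have "has_velocity C (\<lambda>t. chart_inv C \<one> (y t))
        (tangent_map vec_charts C (chart_inv C \<one>) (y t) (right_field \<one> (y t) \<xi>)) t"
      by (rule has_velocity_compose[OF charted_vec y'[OF t, folded has_velocity_vec_iff]
            chart_inv_has_tangent_map[OF smooth_structure y[OF t]]])
    moreover have "tangent_map vec_charts C (chart_inv C \<one>) (y t) (right_field \<one> (y t) \<xi>)
        = TR G (chart_inv C \<one> (y t)) \<xi>"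
      using tangent_chart_inv_map[OF smooth_structure chart_inv_dom[OF charted(1) y[OF t]]]
      by (simp add: chart_map_inv[OF charted(1) y[OF t]] right_field_def)
    ultimately show ?thesis by simp
  qed
  then have "integral_curve C (\<lambda>g. TR G g \<xi>) {- e<..<e} (\<lambda>t. chart_inv C \<one> (y t))"
    by (simp add: integral_curve_def)
  moreover have "chart_inv C \<one> (y 0) = \<one>"
    by (simp add: y0 chart_inv_map[OF charted(1)] chart_dom_self[OF charted(1)])
  ultimately show ?thesis
    using e by (intro exI[of _ e] exI[of _ "\<lambda>t. chart_inv C \<one> (y t)"] conjI)
qed

text \<open>As functions of \<open>s\<close>, both sides solve the same right invariant equation,
  one by translation of time, the other by right translation, and they agree at 0.\<close>

lemma local_integral_curve_add:
  assumes \<gamma>: "integral_curve C (\<lambda>g. TR G g \<xi>) {- e<..<e} \<gamma>" and 1: "\<gamma> 0 = \<one>"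
    and st: "\<bar>s\<bar> < e" "\<bar>t\<bar> < e" "\<bar>s + t\<bar> < e"
  shows "\<gamma> (s + t) = \<gamma> s \<otimes> \<gamma> t"
proof -
  \<comment> \<open>The times \<open>r\<close> for which both \<open>r\<close> and
    \<open>r + t\<close> lie in (-e, e): an interval containing 0 and \<open>s\<close>.\<close>
  let ?I = "{max (- e) (- e - t)<..<min e (e - t)}"
  have vel: "has_velocity C \<gamma> (TR G (\<gamma> r) \<xi>) r" if "\<bar>r\<bar> < e" for r
    proof -
    have "r \<in> {- e<..<e}" using that by auto
    then show ?thesis using \<gamma> unfolding integral_curve_def by blast
  qed
  have "integral_curve C (\<lambda>g. TR G g \<xi>) ?I (\<lambda>r. \<gamma> (r + t))"
    unfolding integral_curve_def
  proof
    fix r assume "r \<in> ?I"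
    then have "\<bar>1 * r + t\<bar> < e" by auto
    from has_velocity_scale[OF charted(1) vel[OF this]]
    show "has_velocity C (\<lambda>r. \<gamma> (r + t)) (TR G (\<gamma> (r + t)) \<xi>) r" by simp
  qed
  moreover have "integral_curve C (\<lambda>g. TR G g \<xi>) ?I (\<lambda>r. \<gamma> r \<otimes> \<gamma> t)"
    unfolding integral_curve_def
  proof
    fix r assume "r \<in> ?I"
    then have "\<bar>r\<bar> < e" by auto
    from has_velocity_compose[OF charted(1) vel[OF this] has_tangent_map_right_mult]
    show "has_velocity C (\<lambda>r. \<gamma> r \<otimes> \<gamma> t) (TR G (\<gamma> r \<otimes> \<gamma> t) \<xi>) r" by (simp add: mult_tangent_TR)
  qed
  ultimately show ?thesis
    by (rule integral_curve_unique[where I = ?I and s = 0, rotated 4]) (use st 1 in auto)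
qed

lemma one_parameter_subgroup:
  "\<exists>\<gamma>. \<gamma> 0 = \<one> \<and> integral_curve C (\<lambda>g. TR G g \<xi>) UNIV \<gamma>"
proof -
  obtain e \<gamma> where e: "e > 0" and 1: "\<gamma> 0 = \<one>"
    and \<gamma>: "integral_curve C (\<lambda>g. TR G g \<xi>) {- e<..<e} \<gamma>"
    using local_integral_curve by blast
  \<comment> \<open>The value at \<open>t\<close> computed from time \<open>t / 2 ^ n\<close>.
    Dyadic division makes consecutive stages differ by one squaring, so the values are stationary in
    \<open>n\<close> once \<open>t / 2 ^ n\<close> lies in the domain of the local curve.\<close>
  define D where "D n t = \<gamma> (t / 2 ^ n) [^] ((2::nat) ^ n)" for n t
  have D_Suc: "D (Suc n) t = D n t" if t: "\<bar>t\<bar> < 2 ^ n * e" for n t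
  proof -
    have "\<bar>t / 2 ^ n\<bar> < e" using t by (simp add: field_simps abs_divide)
    then have "\<gamma> (t / 2 ^ Suc n + t / 2 ^ Suc n) = \<gamma> (t / 2 ^ Suc n) \<otimes> \<gamma> (t / 2 ^ Suc n)"
      using e by (intro local_integral_curve_add[OF \<gamma> 1]) (auto simp: field_simps abs_divide)
    then have "\<gamma> (t / 2 ^ n) = \<gamma> (t / 2 ^ Suc n) [^] (2::nat)"
      by (simp add: numeral_2_eq_2)
    then show ?thesis by (simp add: D_def nat_pow_pow)
  qed
  have D_eq: "D m t = D n t" if "\<bar>t\<bar> < 2 ^ n * e" "n \<le> m" for m n t
    using that(2)
  proof (induct rule: dec_induct)
    case (step k)
    have "(2 :: real) ^ n * e \<le> 2 ^ k * e" using step(1) e by simp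
    then have "\<bar>t\<bar> < 2 ^ k * e" using that(1) by simp
    then show ?case using D_Suc step by simp
  qed simp
  have ex: "\<exists>n. \<bar>t\<bar> < 2 ^ n * e" for t
  proof -
    obtain n where "\<bar>t\<bar> / e < 2 ^ n" using real_arch_pow[of 2 "\<bar>t\<bar> / e"] by auto
    then show ?thesis using e by (auto simp: field_simps)
  qed
  define N where "N t = (LEAST n. \<bar>t\<bar> < 2 ^ n * e)" for t
  have N: "\<bar>t\<bar> < 2 ^ N t * e" for t unfolding N_def by (rule LeastI_ex[OF ex])
  define \<Gamma> where "\<Gamma> t = D (N t) t" for t
  have \<Gamma>D: "\<Gamma> t = D n t" if "N t \<le> n" for n t
    unfolding \<Gamma>_def using D_eq[OF N that] by simp
  \<comment> \<open>At a stage that is final for \<open>s\<close>, \<open>t\<close> and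
    \<open>s + t\<close>, the local law in both orders gives the product formula and shows that the
    factors commute, so the \<open>2 ^ n\<close>-th power of the product splits.\<close>
  have add: "\<Gamma> (s + t) = \<Gamma> s \<otimes> \<Gamma> t" for s t
  proof -
    define n where "n = max (N (s + t)) (max (N s) (N t))"
    have small: "\<bar>r\<bar> / 2 ^ n < e" if "N r \<le> n" for r
    proof -
      have "\<bar>r\<bar> < 2 ^ N r * e" by (rule N)
      also have "\<dots> \<le> 2 ^ n * e" using that e by simp
      finally show ?thesis by (simp add: field_simps)
    qed
    have le: "N (s + t) \<le> n" "N (t + s) \<le> n" "N s \<le> n" "N t \<le> n" by (auto simp: n_def add.commute)
    have "\<gamma> (s / 2 ^ n + t / 2 ^ n) = \<gamma> (s / 2 ^ n) \<otimes> \<gamma> (t / 2 ^ n)"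
      "\<gamma> (t / 2 ^ n + s / 2 ^ n) = \<gamma> (t / 2 ^ n) \<otimes> \<gamma> (s / 2 ^ n)"
      using small[of s] small[of t] small[of "s + t"] le
        local_integral_curve_add[OF \<gamma> 1, of "s / 2 ^ n" "t / 2 ^ n"]
        local_integral_curve_add[OF \<gamma> 1, of "t / 2 ^ n" "s / 2 ^ n"]
      by (simp_all add: add_divide_distrib[symmetric] abs_divide add.commute)
    then have "\<gamma> ((s + t) / 2 ^ n) = \<gamma> (s / 2 ^ n) \<otimes> \<gamma> (t / 2 ^ n)"
      "\<gamma> (s / 2 ^ n) \<otimes> \<gamma> (t / 2 ^ n) = \<gamma> (t / 2 ^ n) \<otimes> \<gamma> (s / 2 ^ n)"
      by (simp_all add: add_divide_distrib add.commute)
    from this(1) pow_mult_distrib[OF this(2) in_carrier in_carrier]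
    have "D n (s + t) = D n s \<otimes> D n t" by (simp only: D_def)
    then show ?thesis using le by (simp add: \<Gamma>D)
  qed
  \<comment> \<open>On the original interval stage 0 is already final, and \<open>D 0 t\<close> is
    \<open>\<gamma> t\<close>.\<close>
  have near: "\<gamma> t = \<Gamma> t" if "t \<in> {- e<..<e}" for t
    using D_eq[of t 0 "N t"] that by (auto simp: \<Gamma>_def D_def)
  have "has_velocity C \<gamma> (TR G (\<gamma> 0) \<xi>) 0" using \<gamma> e by (auto simp: integral_curve_def)
  then have "has_velocity C \<gamma> \<xi> 0" by (simp add: 1 TR_one)
  from has_velocity_transform[OF open_greaterThanLessThan[of "- e" e] _ near this]
  have "has_velocity C \<Gamma> \<xi> 0" using e by simp
  \<comment> \<open>The velocity at 0 is carried to time \<open>t\<close> by writing \<Gamma>(s) as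
    \<Gamma>(s - t) \<Gamma>(t) and right translating.\<close>
  then have "has_velocity C \<Gamma> \<xi> (1 * t + - t)" for t by simp
  from has_velocity_scale[OF charted(1) this]
  have "has_velocity C (\<lambda>s. \<Gamma> (s - t)) \<xi> t" for t by simp
  from has_velocity_compose[OF charted(1) this has_tangent_map_right_mult]
  have *: "has_velocity C (\<lambda>s. \<Gamma> (s - t) \<otimes> \<Gamma> t) (mult_tangent (\<Gamma> 0) (\<Gamma> t) (\<xi>, 0)) t" for t by simp
  have \<Gamma>0: "\<Gamma> 0 = \<one>" using near[of 0] e 1 by simp
  have "has_velocity C \<Gamma> (TR G (\<Gamma> t) \<xi>) t" for t
    using *[of t] by (simp add: add[symmetric] \<Gamma>0 TR_eq)
  then show ?thesis using \<Gamma>0 by (auto simp: integral_curve_def)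
qed

text \<open>Rescaling time by \<open>t\<close> gives an integral curve for
  \<open>t *\<^sub>R \<xi>\<close>. By uniqueness it is the one described in \<open>lie_exp\<close>,
  and its value at 1 is read off.\<close>

lemma lie_exp_scaleR:
  assumes "\<gamma> 0 = \<one>" and \<gamma>: "integral_curve C (\<lambda>g. TR G g \<xi>) UNIV \<gamma>"
  shows "lie_exp G (t *\<^sub>R \<xi>) = \<gamma> t"
proof -
  have curve: "integral_curve C (\<lambda>g. TR G g (t *\<^sub>R \<xi>)) UNIV (\<lambda>s. \<gamma> (t * s))"
    unfolding integral_curve_def
  proof
    fix s
    have "has_velocity C \<gamma> (TR G (\<gamma> (t * s + 0)) \<xi>) (t * s + 0)" using \<gamma> by (simp add: integral_curve_def)
    from has_velocity_scale[OF charted(1) this]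
    show "has_velocity C (\<lambda>s. \<gamma> (t * s)) (TR G (\<gamma> (t * s)) (t *\<^sub>R \<xi>)) s"
      by (simp add: linear_cmul[OF bounded_linear.linear[OF TR_bounded_linear]])
  qed
  have "(THE \<delta>. \<delta> 0 = \<one> \<and> integral_curve C (\<lambda>g. TR G g (t *\<^sub>R \<xi>)) UNIV \<delta>) = (\<lambda>s. \<gamma> (t * s))"
  proof (rule the_equality)
    fix \<delta> assume d: "\<delta> 0 = \<one> \<and> integral_curve C (\<lambda>g. TR G g (t *\<^sub>R \<xi>)) UNIV \<delta>"
    show "\<delta> = (\<lambda>s. \<gamma> (t * s))"
    proof
      fix s show "\<delta> s = \<gamma> (t * s)"
        by (rule integral_curve_unique[OF open_UNIV connected_UNIV UNIV_I UNIV_I _ curve, of \<delta> 0])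
          (use d assms(1) in auto)
    qed
  qed (use curve assms(1) in auto)
  then show ?thesis by (simp add: lie_exp_def)
qed

section \<open>The adjoint action and its derivative, the bracket\<close>

lemma Ad_has_tangent_map: "has_tangent_map C C (\<lambda>h. inv g \<otimes> h \<otimes> g) \<one> (Ad G g)"
proof -
  have "has_tangent_map C C (\<lambda>h. inv g \<otimes> h \<otimes> g) \<one>
      (\<lambda>v. mult_tangent (inv g \<otimes> \<one>) g (mult_tangent (inv g) \<one> (0, v), 0))"
    by (rule has_tangent_map_compose[OF charted(1,1) has_tangent_map_left_mult has_tangent_map_right_mult])
  then show ?thesis using has_tangent_map_eq by (metis Ad_def)
qed

lemma Ad_linear: "linear (Ad G g)"
  by (rule bounded_linear.linear[OF has_tangent_map_linear[OF Ad_has_tangent_map]])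

text \<open>\<open>Ad\<close> is the partial derivative of conjugation in the conjugated element, at
  the identity. Its smoothness in the conjugating element is inherited from inversion and two
  multiplications, composed in the chart at the identity.\<close>

lemma Ad_smooth:
  obtains U where "open U" "chart_map C \<one> \<one> \<in> U"
    "\<And>\<eta>. smooth_on U (\<lambda>a. Ad G (chart_inv C \<one> a) \<eta>)"
proof -
  let ?P = "prod_charts C C" and ?mult = "\<lambda>(g, h). g \<otimes> h" and ?inv = "\<lambda>g. inv g"
  let ?\<phi> = "chart_map C \<one>" and ?\<psi> = "chart_inv C \<one>" and ?D = "chart_dom C \<one>"
  let ?A = "?\<phi> ` ?D" and ?o = "?\<phi> \<one>"
  note ch = charted(1)
  define m where "m = ?\<phi> \<circ> ?mult \<circ> chart_inv ?P (\<one>, \<one>)"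
  define i where "i = ?\<phi> \<circ> ?inv \<circ> ?\<psi>"
  define M where "M = chart_map ?P (\<one>, \<one>) ` (chart_dom ?P (\<one>, \<one>) \<inter> ?mult -` ?D)"
  define J where "J = ?\<phi> ` (?D \<inter> ?inv -` ?D)"
  have m: "smooth_on M m" and i: "smooth_on J i"
    using smooth_mult smooth_inv unfolding smooth_map_def M_def m_def J_def i_def by blast+
  have oM: "open M" and oJ: "open J"
    unfolding M_def J_def
    by (rule smooth_map_open[OF charted(2,1) smooth_mult], rule smooth_map_open[OF ch ch smooth_inv])
  have oA: "open ?A" by (rule open_chart_image[OF ch])
  have D1: "\<one> \<in> ?D" by (rule chart_dom_self[OF ch])
  have MI: "(?\<phi> g, ?\<phi> h) \<in> M" if "g \<in> ?D" "h \<in> ?D" "g \<otimes> h \<in> ?D" for g h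
    unfolding M_def by (rule image_eqI[of _ _ "(g, h)"]) (use that in auto)
  have mE: "a \<in> ?A \<and> b \<in> ?A \<and> m (a, b) \<in> ?A \<and> ?\<psi> (m (a, b)) = ?\<psi> a \<otimes> ?\<psi> b" if "(a, b) \<in> M" for a b
    using that by (auto simp: M_def m_def prod_charts_inv[OF ch ch] chart_inv_map[OF ch])
  have iE: "a \<in> ?A \<and> i a \<in> ?A \<and> ?\<psi> (i a) = inv (?\<psi> a)" if "a \<in> J" for a
    using that by (auto simp: J_def i_def chart_inv_map[OF ch])
  obtain B :: "'e set" and \<phi> where F: "frame B \<phi> (\<lambda>b. b)" using frame_ex by blast
  \<comment> \<open>Chart formulas compose only while all intermediate points stay in the chart
    domain. For conjugating element g and conjugated element h, \<open>W0\<close>, \<open>W1\<close>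
    and \<open>W\<close> ensure this in turn for inv g, inv g h and inv g h g.\<close>
  define W0 where "W0 = J \<times> ?A"
  define f0 where "f0 p = (i (fst p), snd p)" for p :: "'e \<times> 'e"
  define W1 where "W1 = W0 \<inter> f0 -` M"
  define f1 where "f1 p = (m (f0 p), fst p)" for p
  define W where "W = W1 \<inter> f1 -` M"
  have o0: "open W0" using oA oJ by (simp add: W0_def open_Times)
  have f0: "smooth_on W0 f0"
    unfolding f0_def
    by (rule smooth_on_Pair[OF o0 smooth_on_compose[OF F o0 _ smooth_on_linear[OF bounded_linear_fst o0] i]
          smooth_on_linear[OF bounded_linear_snd o0]]) (auto simp: W0_def)
  have o1: "open W1"
    unfolding W1_def by (rule continuous_open_preimage[OF smooth_on_continuous[OF f0] o0 oM])
  have f1: "smooth_on W1 f1"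
    unfolding f1_def
    by (rule smooth_on_Pair[OF o1 smooth_on_compose[OF frame_Times[OF F F] o1 _ smooth_on_subset[OF f0] m]
          smooth_on_linear[OF bounded_linear_fst o1]]) (auto simp: W1_def)
  have oW: "open W"
    unfolding W_def by (rule continuous_open_preimage[OF smooth_on_continuous[OF f1] o1 oM])
  have K: "smooth_on W (\<lambda>p. m (f1 p))"
    by (rule smooth_on_compose[OF frame_Times[OF F F] oW _ smooth_on_subset[OF f1] m]) (auto simp: W_def)
  have Kval: "m (f1 (a, b)) = ?\<phi> (inv (?\<psi> a) \<otimes> ?\<psi> b \<otimes> ?\<psi> a)" if "(a, b) \<in> W" for a b
  proof -
    have M0: "a \<in> J" "(i a, b) \<in> M" "(m (i a, b), a) \<in> M"
      using that by (auto simp: W_def W1_def W0_def f0_def f1_def)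
    have "?\<psi> (m (m (i a, b), a)) = inv (?\<psi> a) \<otimes> ?\<psi> b \<otimes> ?\<psi> a"
      using mE[OF M0(2)] mE[OF M0(3)] iE[OF M0(1)] by simp
    moreover have "m (m (i a, b), a) \<in> ?A" using mE[OF M0(3)] by simp
    ultimately show ?thesis using chart_map_inv[OF ch] by (metis f0_def f1_def fst_conv snd_conv)
  qed
  have oJ1: "?o \<in> J" using D1 by (auto simp: J_def)
  have io: "i ?o = ?o" by (simp add: i_def chart_inv_map[OF ch D1])
  have mo: "m (?o, ?o) = ?o"
    using D1 by (simp add: m_def prod_charts_inv[OF ch ch] chart_inv_map[OF ch D1])
  have W: "(?o, ?o) \<in> W"
    using oJ1 D1 MI[OF D1 D1] by (auto simp: W_def W1_def W0_def f0_def f1_def io mo)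
  define U where "U = (\<lambda>a. (a, ?o)) -` W"
  have oU: "open U" unfolding U_def by (rule open_vimage[OF oW]) (intro continuous_intros)
  \<comment> \<open>Conjugation fixes the identity, so \<open>Ad\<close> always has values in the
    chart there, and both sides differentiate the same function of the second coordinate.\<close>
  have Ad: "Ad G (?\<psi> a) \<eta> = frechet_derivative (\<lambda>p. m (f1 p)) (at (a, ?o)) (0, \<eta>)" if a: "a \<in> U" for a \<eta>
  proof -
    have aW: "(a, ?o) \<in> W" using a by (simp add: U_def)
    have "((?\<phi> \<circ> (\<lambda>h. inv (?\<psi> a) \<otimes> h \<otimes> ?\<psi> a) \<circ> ?\<psi>) has_derivative Ad G (?\<psi> a)) (at ?o)"
      using Ad_has_tangent_map[of "?\<psi> a"] by (simp add: has_tangent_map_def)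
    then have 1: "((\<lambda>b. m (f1 (a, b))) has_derivative Ad G (?\<psi> a)) (at ?o)"
    proof (rule has_derivative_transform_within_open)
      show "open (Pair a -` W)" by (rule open_vimage[OF oW]) (intro continuous_intros)
    qed (use aW in \<open>auto simp: Kval\<close>)
    have "(Pair a has_derivative (\<lambda>\<eta>. (0, \<eta>))) (at ?o)"
      by (auto intro!: derivative_eq_intros)
    from has_derivative_compose[OF this smooth_on_has_derivative[OF K aW]]
    have "((\<lambda>b. m (f1 (a, b))) has_derivative
      (\<lambda>\<eta>. frechet_derivative (\<lambda>p. m (f1 p)) (at (a, ?o)) (0, \<eta>))) (at ?o)" .
    from has_derivative_unique[OF 1 this] show ?thesis by metis
  qed
  show thesis
  proof (rule that[OF oU])
    show "?o \<in> U" using W by (simp add: U_def)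
    fix \<eta>
    have "smooth_on U (\<lambda>a. frechet_derivative (\<lambda>p. m (f1 p)) (at (a, ?o)) (0, \<eta>))"
      by (rule smooth_on_derivative_apply[OF frame_Times[OF F F] oU
            smooth_on_Pair[OF oU smooth_on_linear[OF bounded_linear_ident oU] smooth_on_const[OF oU]] _ K
            smooth_on_const[OF oU]]) (simp add: U_def)
    moreover have "smooth_on U (\<lambda>a. Ad G (?\<psi> a) \<eta>) \<longleftrightarrow>
        smooth_on U (\<lambda>a. frechet_derivative (\<lambda>p. m (f1 p)) (at (a, ?o)) (0, \<eta>))"
      by (rule smooth_on_cong[OF oU]) (rule Ad)
    ultimately show "smooth_on U (\<lambda>a. Ad G (?\<psi> a) \<eta>)" by (rule iffD2[rotated])
  qed
qed

lemma Ad_has_derivative: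
  "((\<lambda>a. Ad G (chart_inv C \<one> a) \<eta>) has_derivative
     frechet_derivative (\<lambda>a. Ad G (chart_inv C \<one> a) \<eta>) (at (chart_map C \<one> \<one>))) (at (chart_map C \<one> \<one>))"
  using Ad_smooth smooth_on_has_derivative by (metis (no_types, lifting))

lemma Ad_one_parameter_derivative:
  assumes 1: "\<gamma> 0 = \<one>" and \<gamma>: "integral_curve C (\<lambda>g. TR G g \<xi>) UNIV \<gamma>"
  shows "((\<lambda>t. Ad G (\<gamma> t) \<eta>) has_vector_derivative
    frechet_derivative (\<lambda>a. Ad G (chart_inv C \<one> a) \<eta>) (at (chart_map C \<one> \<one>)) \<xi>) (at 0)"
proof -
  let ?f = "\<lambda>a. Ad G (chart_inv C \<one> a) \<eta>" and ?o = "chart_map C \<one> \<one>"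
  have "has_velocity C \<gamma> (TR G (\<gamma> 0) \<xi>) 0" using \<gamma> by (simp add: integral_curve_def)
  then have v: "isCont \<gamma> 0" "((\<lambda>s. chart_map C \<one> (\<gamma> s)) has_vector_derivative \<xi>) (at 0)"
    by (auto simp: has_velocity_def 1 TR_one)
  obtain U where U: "open U" "0 \<in> U" "\<And>s. s \<in> U \<Longrightarrow> \<gamma> s \<in> chart_dom C \<one>"
    using v(1) open_chart_dom[OF charted(1)] chart_dom_self[OF charted(1), of \<one>] 1
    unfolding continuous_at_open by metis
  have "((\<lambda>s. ?f (chart_map C \<one> (\<gamma> s))) has_derivative
      (\<lambda>s. frechet_derivative ?f (at ?o) (s *\<^sub>R \<xi>))) (at 0)"
    by (rule has_derivative_compose[OF v(2)[unfolded has_vector_derivative_def]])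
      (use Ad_has_derivative[of \<eta>] in \<open>simp add: 1\<close>)
  then have "((\<lambda>s. ?f (chart_map C \<one> (\<gamma> s))) has_vector_derivative frechet_derivative ?f (at ?o) \<xi>) (at 0)"
    by (simp add: has_vector_derivative_def linear_cmul[OF has_derivative_linear[OF Ad_has_derivative]])
  then show ?thesis
    by (rule has_vector_derivative_transform_within_open[OF _ U(1,2)])
      (simp add: chart_inv_map[OF charted(1)] U(3))
qed

text \<open>By the chain rule only the initial velocity of the one-parameter subgroup matters. This
  exposes the linearity in \<open>\<xi>\<close>, which the definition through the exponential map
  hides.\<close>

lemma lie_bracket_eq:
  "lie_bracket G \<xi> \<eta> = frechet_derivative (\<lambda>a. Ad G (chart_inv C \<one> a) \<eta>) (at (chart_map C \<one> \<one>)) \<xi>"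
proof -
  obtain \<gamma> where \<gamma>: "\<gamma> 0 = \<one>" "integral_curve C (\<lambda>g. TR G g \<xi>) UNIV \<gamma>"
    using one_parameter_subgroup by blast
  show ?thesis
    unfolding lie_bracket_def lie_exp_scaleR[OF \<gamma>]
    by (rule vector_derivative_at[OF Ad_one_parameter_derivative[OF \<gamma>]])
qed

text \<open>Linearity in the first argument is that of a derivative; in the second it comes from
  linearity of each \<open>Ad G g\<close>, which survives differentiation in
  \<open>g\<close>.\<close>

lemma lie_bracket_bilinear: "bounded_bilinear (lie_bracket G)"
proof -
  obtain B :: "'e set" and \<phi> where F: "frame B \<phi> (\<lambda>b. b)" using frame_ex by blast
  show ?thesis
  proof (rule frame_bilinear_bounded[OF F F])
    show "linear (\<lambda>\<xi>. lie_bracket G \<xi> \<eta>)" for \<eta>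
      unfolding lie_bracket_eq by (rule has_derivative_linear[OF Ad_has_derivative])
    show "linear (lie_bracket G \<xi>)" for \<xi>
    proof (rule linearI)
      fix \<eta> \<theta> and r :: real
      show "lie_bracket G \<xi> (\<eta> + \<theta>) = lie_bracket G \<xi> \<eta> + lie_bracket G \<xi> \<theta>"
        unfolding lie_bracket_eq
        using has_derivative_unique[OF Ad_has_derivative[of "\<eta> + \<theta>", unfolded linear_add[OF Ad_linear]]
            has_derivative_add[OF Ad_has_derivative[of \<eta>] Ad_has_derivative[of \<theta>]]]
        by (simp add: linear_add[OF Ad_linear])
      show "lie_bracket G \<xi> (r *\<^sub>R \<eta>) = r *\<^sub>R lie_bracket G \<xi> \<eta>"
        unfolding lie_bracket_eq
        using has_derivative_unique[OF Ad_has_derivative[of "r *\<^sub>R \<eta>", unfolded linear_cmul[OF Ad_linear]]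
            has_derivative_scaleR_right[OF Ad_has_derivative[of \<eta>], of r]]
        by (simp add: linear_cmul[OF Ad_linear])
    qed
  qed
qed

lemma lie_bracket_self: "lie_bracket G \<xi> \<xi> = 0"
proof -
  obtain \<gamma> where \<gamma>: "\<gamma> 0 = \<one>" "integral_curve C (\<lambda>g. TR G g \<xi>) UNIV \<gamma>"
    using one_parameter_subgroup by blast
  have vel: "has_velocity C \<gamma> (TR G (\<gamma> t) \<xi>) t" for t
    using \<gamma>(2) by (simp add: integral_curve_def)
  have add: "\<gamma> (s + t) = \<gamma> s \<otimes> \<gamma> t" for s t
  proof -
    \<comment> \<open>Any bound exceeding |s|, |t| and |s + t| lets the local addition law apply to
      the global curve.\<close>
    define e where "e = 1 + \<bar>s\<bar> + \<bar>t\<bar>"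
    have "integral_curve C (\<lambda>g. TR G g \<xi>) {- e<..<e} \<gamma>" using vel by (simp add: integral_curve_def)
    from local_integral_curve_add[OF this \<gamma>(1)] show ?thesis by (simp add: e_def)
  qed
  have "Ad G (\<gamma> t) \<xi> = \<xi>" for t
  proof -
    have "inv (\<gamma> t) \<otimes> \<gamma> s \<otimes> \<gamma> t = \<gamma> s" for s
      using add[of s t] add[of t s] by (simp add: m_assoc add.commute inv_solve_left')
    moreover have "has_velocity C \<gamma> \<xi> 0" using vel[of 0] by (simp add: \<gamma>(1) TR_one)
    moreover from this have "has_velocity C (\<lambda>s. inv (\<gamma> t) \<otimes> \<gamma> s \<otimes> \<gamma> t) (Ad G (\<gamma> t) \<xi>) 0"
      by (rule has_velocity_compose[OF charted(1)]) (simp add: \<gamma>(1) Ad_has_tangent_map)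
    ultimately show ?thesis using has_velocity_unique by simp
  qed
  then show ?thesis by (simp add: lie_bracket_def lie_exp_scaleR[OF \<gamma>])
qed

lemma lie_bracket_antisym: "lie_bracket G \<eta> \<xi> = - lie_bracket G \<xi> \<eta>"
proof -
  interpret bounded_bilinear "lie_bracket G" by (rule lie_bracket_bilinear)
  have "0 = lie_bracket G (\<xi> + \<eta>) (\<xi> + \<eta>)" by (simp add: lie_bracket_self)
  also have "\<dots> = lie_bracket G \<eta> \<xi> + lie_bracket G \<xi> \<eta>"
    by (simp add: add_left add_right lie_bracket_self[of \<xi>] lie_bracket_self[of \<eta>])
  finally show ?thesis by (metis eq_neg_iff_add_eq_0)
qed

end

section \<open>Hamilton's equations\<close>

text \<open>Componentwise test, for functions known only through their pairings, such as the partial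
  derivatives of \<open>H\<close>.\<close>

lemma smooth_on_frame:
  fixes b :: "'i \<Rightarrow> 'b::real_normed_vector" and f :: "'a::real_normed_vector \<Rightarrow> 'b"
  assumes F: "frame I \<phi> b" and S: "open S" and f: "\<And>i. smooth_on S (\<lambda>y. \<phi> i (f y))"
  shows "smooth_on S f"
proof -
  have "smooth_on S (\<lambda>y. \<Sum>i\<in>I. \<phi> i (f y) *\<^sub>R b i)"
    by (rule smooth_on_sum[OF S])
      (rule smooth_on_bilinear[OF bounded_bilinear_scaleR S f smooth_on_const[OF S]])
  then show ?thesis by (simp only: frame_expand[OF F])
qed

text \<open>Reflexivity of a finite-dimensional space; it gives meaning to the definite descriptions
  in \<open>\<delta>\<mu>\<close> and \<open>\<delta>\<nu>\<close>.\<close>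

lemma dual_bounded_linear_ex1:
  fixes b :: "'i \<Rightarrow> 'a::real_normed_vector" and l :: "'a dual \<Rightarrow> real"
  assumes F: "frame I \<phi> b" and l: "linear l"
  shows "\<exists>!\<zeta>. \<forall>\<kappa>. blinfun_apply \<kappa> \<zeta> = l \<kappa>"
proof (rule ex1I[of _ "\<Sum>i\<in>I. l (Blinfun (\<phi> i)) *\<^sub>R b i"])
  show "\<forall>\<kappa>. blinfun_apply \<kappa> (\<Sum>i\<in>I. l (Blinfun (\<phi> i)) *\<^sub>R b i) = l \<kappa>"
  proof
    fix \<kappa>
    have "l \<kappa> = (\<Sum>i\<in>I. blinfun_apply \<kappa> (b i) *\<^sub>R l (Blinfun (\<phi> i)))"
      by (rule linear_frame_expand[OF frame_dual[OF F] l])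
    then show "blinfun_apply \<kappa> (\<Sum>i\<in>I. l (Blinfun (\<phi> i)) *\<^sub>R b i) = l \<kappa>"
      by (simp only: blinfun.sum_right blinfun.scaleR_right real_scaleR_def mult.commute)
  qed
  fix \<zeta> assume "\<forall>\<kappa>. blinfun_apply \<kappa> \<zeta> = l \<kappa>"
  then have h: "\<phi> i \<zeta> = l (Blinfun (\<phi> i))" for i
    using bounded_linear_Blinfun_apply[OF frame_bounded_linear[OF F]] by metis
  show "\<zeta> = (\<Sum>i\<in>I. l (Blinfun (\<phi> i)) *\<^sub>R b i)"
    unfolding h[symmetric] by (rule frame_expand[OF F, symmetric])
qed

lemma prod_vec_charts: "prod_charts vec_charts vec_charts = vec_charts"
  by (rule ext) (auto simp: prod_charts_def vec_charts_def[of "(_, _)"] map_prod.id split: prod.split)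

section \<open>Generators and the symplectic form at a point\<close>

context lie_group
begin

lemma charted_phase: "charted (phase_charts G)"
  unfolding phase_charts_def by (rule charted_prod[OF charted(1) charted_vec])

lemma dual_eqI:
  assumes "\<And>\<kappa> :: 'e dual. blinfun_apply \<kappa> x = blinfun_apply \<kappa> y"
  shows "x = y"
proof -
  obtain B :: "'e set" and \<phi> where F: "frame B \<phi> (\<lambda>b. b)" using frame_ex by blast
  show ?thesis
    using dual_bounded_linear_ex1[OF F, of "\<lambda>\<kappa>. blinfun_apply \<kappa> y"] assms
    by (auto simp: linear_iff blinfun.add_left blinfun.scaleR_left)
qed

lemma ad_star_apply: "blinfun_apply (ad_star G \<xi> \<mu>) \<eta> = blinfun_apply \<mu> (lie_bracket G \<xi> \<eta>)"
proof -
  have "bounded_linear (\<lambda>\<eta>. blinfun_apply \<mu> (lie_bracket G \<xi> \<eta>))"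
    by (rule bounded_linear_compose[OF blinfun.bounded_linear_right
          bounded_bilinear.bounded_linear_right[OF lie_bracket_bilinear]])
  then show ?thesis by (simp add: ad_star_def bounded_linear_Blinfun_apply)
qed

lemma TR_dual_apply: "blinfun_apply (TR_dual G g \<alpha>) \<eta> = blinfun_apply \<alpha> (TR G g \<eta>)"
  unfolding TR_dual_def
  by (simp add: bounded_linear_Blinfun_apply
      bounded_linear_compose[OF blinfun.bounded_linear_right TR_bounded_linear])

lemmas bracket_simps =
  bounded_bilinear.add_left[OF lie_bracket_bilinear] bounded_bilinear.add_right[OF lie_bracket_bilinear]
  bounded_bilinear.minus_left[OF lie_bracket_bilinear] bounded_bilinear.minus_right[OF lie_bracket_bilinear]
  bounded_bilinear.zero_left[OF lie_bracket_bilinear] bounded_bilinear.zero_right[OF lie_bracket_bilinear]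
  bounded_bilinear.scaleR_left[OF lie_bracket_bilinear] bounded_bilinear.scaleR_right[OF lie_bracket_bilinear]

lemma ad_star_bilinear: "bounded_bilinear (ad_star G)"
proof -
  obtain B :: "'e set" and \<phi> where F: "frame B \<phi> (\<lambda>b. b)" using frame_ex by blast
  show ?thesis
    by (rule frame_bilinear_bounded[OF F frame_dual[OF F]])
      (auto intro!: linearI blinfun_eqI
        simp: ad_star_apply blinfun.add_left blinfun.scaleR_left bracket_simps
          blinfun.add_right blinfun.scaleR_right)
qed

lemmas ad_star_zero [simp] =
  bounded_bilinear.zero_left[OF ad_star_bilinear] bounded_bilinear.zero_right[OF ad_star_bilinear]

text \<open>The system is triangular: the group component determines \<open>\<eta>\<close> because
  \<open>TR\<close> is bijective, and then each remaining component contains one new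
  unknown.\<close>

lemma right_invariant_field_inj:
  "right_invariant_field G a p = right_invariant_field G b p \<Longrightarrow> a = b"
  by (cases p; cases a; cases b) (auto simp: inj_eq[OF bij_is_inj[OF TR_bij]])

lemma right_invariant_field_surj: "\<exists>a. right_invariant_field G a p = v"
proof -
  obtain g \<mu> \<nu> \<xi> u \<alpha> \<beta> x where pv: "p = (g, \<mu>, \<nu>, \<xi>)" "v = (u, \<alpha>, \<beta>, x)"
    by (metis prod_cases4)
  obtain \<eta> where \<eta>: "u = TR G g \<eta>" using bij_is_surj[OF TR_bij] by (metis surjD)
  let ?\<kappa> = "\<alpha> - ad_star G \<eta> \<mu>"
  show ?thesis
    by (rule exI[of _ "(\<eta>, ?\<kappa>, \<beta> - ad_star G \<eta> \<nu> + ad_star G \<xi> ?\<kappa>, x - lie_bracket G \<xi> \<eta>)"])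
      (simp add: pv \<eta>)
qed

lemma generator_right_invariant_field: "generator G p (right_invariant_field G a p) = a"
  unfolding generator_def by (rule the_equality) (auto dest: right_invariant_field_inj)

text \<open>Test vectors with a single nonzero slot isolate the components. The order matters:
  \<open>\<eta>\<close> and \<open>\<kappa>1\<close> come first, since the remaining two tests also
  contain bracket terms in them.\<close>

lemma symplectic_nondegenerate:
  assumes "\<And>b. symplectic_on_generators G p a b = symplectic_on_generators G p a' b"
  shows "a = a'"
proof -
  obtain g \<mu> \<nu> \<xi> where p: "p = (g, \<mu>, \<nu>, \<xi>)" by (metis prod_cases4)
  obtain \<eta> \<kappa>1 \<kappa>2 \<zeta> where a: "a = (\<eta>, \<kappa>1, \<kappa>2, \<zeta>)" by (metis prod_cases4)
  obtain \<eta>' \<kappa>1' \<kappa>2' \<zeta>' where a': "a' = (\<eta>', \<kappa>1', \<kappa>2', \<zeta>')" by (metis prod_cases4)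
  note eqs = assms[unfolded p a a']
  have \<eta>: "\<eta> = \<eta>'"
    using eqs[of "(0, 0, _, 0)"] by (intro dual_eqI) (simp add: bracket_simps)
  have \<kappa>1: "\<kappa>1 = \<kappa>1'"
    using eqs[of "(0, 0, 0, _)"] by (intro blinfun_eqI) (simp add: bracket_simps blinfun.minus_right)
  have "\<zeta> - lie_bracket G \<eta> \<xi> = \<zeta>' - lie_bracket G \<eta>' \<xi>"
    using eqs[of "(0, _, 0, 0)"] by (intro dual_eqI) (simp add: bracket_simps)
  moreover have "\<kappa>2 = \<kappa>2'"
    using eqs[of "(_, 0, 0, 0)"] \<eta> \<kappa>1 by (intro blinfun_eqI) simp
  ultimately show ?thesis using \<eta> \<kappa>1 by (simp add: a a')
qed

section \<open>Partial derivatives and the solution of Hamilton's equation\<close>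

context
  fixes H :: "('g, 'e) phase \<Rightarrow> real"
  assumes H: "smooth_map (phase_charts G) vec_charts H"
begin

definition dH where "dH = tangent_map (phase_charts G) vec_charts H"

lemma dH_has_tangent_map: "has_tangent_map (phase_charts G) vec_charts H p (dH p)"
  unfolding dH_def by (rule smooth_map_has_tangent_map[OF charted_phase charted_vec H])

lemma dH_linear: "linear (dH p)"
  by (rule bounded_linear.linear[OF has_tangent_map_linear[OF dH_has_tangent_map]])

text \<open>The vector factors carry flat charts, so an ordinary derivative along the fibre is a
  value of the differential of \<open>H\<close>.\<close>

lemma fiber_derivative:
  assumes "(f has_derivative f') (at x)"
  shows "((\<lambda>y. H (g, f y)) has_derivative (\<lambda>v. dH (g, f x) (0, f' v))) (at x)"
proof -
  have "has_tangent_map vec_charts (phase_charts G) (\<lambda>y. (g, f y)) x (\<lambda>v. (0, f' v))"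
    unfolding phase_charts_def
    by (rule has_tangent_map_Pair[OF has_tangent_map_const]) (simp add: has_tangent_map_vec_iff assms)
  from has_tangent_map_compose[OF charted_vec charted_phase this dH_has_tangent_map]
  show ?thesis by (simp add: has_tangent_map_vec_iff)
qed

lemma delta_g_apply: "blinfun_apply (\<delta>g G H (g, w)) u = dH (g, w) (u, 0)"
proof -
  have "has_tangent_map C (phase_charts G) (\<lambda>h. (h, w)) g (\<lambda>u. (u, 0))"
    unfolding phase_charts_def
    by (rule has_tangent_map_Pair[OF has_tangent_map_ident[OF charted(1)] has_tangent_map_const])
  from has_tangent_map_compose[OF charted(1) charted_phase this dH_has_tangent_map]
  have "has_tangent_map C vec_charts (\<lambda>h. H (h, w)) g (\<lambda>u. dH (g, w) (u, 0))" .
  from has_tangent_map_eq[OF this] has_tangent_map_linear[OF this] show ?thesis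
    by (cases w) (simp add: bounded_linear_Blinfun_apply)
qed

lemma dual_the:
  fixes f :: "'e dual \<Rightarrow> real"
  assumes "(f has_derivative l) (at x)"
  shows "blinfun_apply \<kappa> (THE \<zeta> :: 'e. \<forall>\<kappa>. blinfun_apply \<kappa> \<zeta> = frechet_derivative f (at x) \<kappa>) = l \<kappa>"
proof -
  obtain B :: "'e set" and \<phi> where F: "frame B \<phi> (\<lambda>b. b)" using frame_ex by blast
  from theI'[OF dual_bounded_linear_ex1[OF F has_derivative_linear[OF assms]]]
  show ?thesis by (simp add: frechet_derivative_at[OF assms, symmetric])
qed

lemma delta_mu_apply: "blinfun_apply \<kappa> (\<delta>\<mu> H (g, \<mu>, \<nu>, \<xi>)) = dH (g, \<mu>, \<nu>, \<xi>) (0, \<kappa>, 0, 0)"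
proof -
  have "((\<lambda>m. (m, \<nu>, \<xi>)) has_derivative (\<lambda>\<kappa>. (\<kappa>, 0, 0))) (at \<mu>)"
    by (auto intro!: derivative_eq_intros simp: zero_prod_def)
  from dual_the[OF fiber_derivative[OF this]] show ?thesis by simp
qed

lemma delta_nu_apply: "blinfun_apply \<kappa> (\<delta>\<nu> H (g, \<mu>, \<nu>, \<xi>)) = dH (g, \<mu>, \<nu>, \<xi>) (0, 0, \<kappa>, 0)"
proof -
  have "((\<lambda>n. (\<mu>, n, \<xi>)) has_derivative (\<lambda>\<kappa>. (0, \<kappa>, 0))) (at \<nu>)"
    by (auto intro!: derivative_eq_intros)
  from dual_the[OF fiber_derivative[OF this]] show ?thesis by simp
qed

lemma delta_xi_apply: "blinfun_apply (\<delta>\<xi> H (g, \<mu>, \<nu>, \<xi>)) x = dH (g, \<mu>, \<nu>, \<xi>) (0, 0, 0, x)"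
proof -
  have "((\<lambda>z. (\<mu>, \<nu>, z)) has_derivative (\<lambda>x. (0, 0, x))) (at \<xi>)"
    by (auto intro!: derivative_eq_intros)
  from fiber_derivative[OF this]
  have "((\<lambda>z. H (g, \<mu>, \<nu>, z)) has_derivative (\<lambda>x. dH (g, \<mu>, \<nu>, \<xi>) (0, 0, 0, x))) (at \<xi>)" by simp
  from frechet_derivative_at[OF this, symmetric] has_derivative_bounded_linear[OF this] show ?thesis
    by (simp add: bounded_linear_Blinfun_apply)
qed

lemma dH_partials:
  assumes "p = (g, \<mu>, \<nu>, \<xi>)"
  shows "dH p (u, \<alpha>, \<beta>, x) = blinfun_apply (\<delta>g G H p) u + blinfun_apply \<alpha> (\<delta>\<mu> H p) +
    blinfun_apply \<beta> (\<delta>\<nu> H p) + blinfun_apply (\<delta>\<xi> H p) x"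
  unfolding assms delta_g_apply delta_mu_apply delta_nu_apply delta_xi_apply
  by (simp add: linear_add[OF dH_linear, symmetric] zero_prod_def)

fun hamilton_generator :: "('g, 'e) phase \<Rightarrow> 'e phase_tangent" where
  "hamilton_generator (g, \<mu>, \<nu>, \<xi>) = (\<delta>\<nu> H (g, \<mu>, \<nu>, \<xi>), \<delta>\<xi> H (g, \<mu>, \<nu>, \<xi>),
     ad_star G (\<delta>\<mu> H (g, \<mu>, \<nu>, \<xi>)) \<mu> - TR_dual G g (\<delta>g G H (g, \<mu>, \<nu>, \<xi>)), - \<delta>\<mu> H (g, \<mu>, \<nu>, \<xi>))"

lemma hamilton_generator_solves:
  "symplectic_on_generators G p (hamilton_generator p) b = - dH p (right_invariant_field G b p)"
proof -
  obtain g \<mu> \<nu> \<xi> where p: "p = (g, \<mu>, \<nu>, \<xi>)" by (metis prod_cases4)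
  obtain \<eta> \<kappa>1 \<kappa>2 \<zeta> where b: "b = (\<eta>, \<kappa>1, \<kappa>2, \<zeta>)" by (metis prod_cases4)
  show ?thesis
    unfolding b p hamilton_generator.simps right_invariant_field.simps
      symplectic_on_generators.simps dH_partials[OF refl]
    \<comment> \<open>After expansion the two sides differ only by the order of four brackets, those
      paired with \<delta>\<xi>, \<mu>, \<nu> and \<kappa>1 respectively.\<close>
    using lie_bracket_antisym[of \<eta> \<xi>] lie_bracket_antisym[of \<eta> "\<delta>\<mu> H (g, \<mu>, \<nu>, \<xi>)"]
      lie_bracket_antisym[of \<eta> "\<delta>\<nu> H (g, \<mu>, \<nu>, \<xi>)"] lie_bracket_antisym[of "\<delta>\<nu> H (g, \<mu>, \<nu>, \<xi>)" \<xi>]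
    by (simp add: ad_star_apply TR_dual_apply blinfun.add_left blinfun.diff_left blinfun.add_right
        blinfun.diff_right blinfun.minus_right)
qed

text \<open>The equation is a linear condition at each point separately. Nondegeneracy fixes the
  generator there, so uniqueness holds among arbitrary fields, smooth or not.\<close>

lemma satisfies_hamilton_equation_iff:
  "satisfies_hamilton_equation G H X \<longleftrightarrow>
    X = (\<lambda>p. right_invariant_field G (hamilton_generator p) p)" (is "?L \<longleftrightarrow> X = ?X")
proof
  assume L: ?L
  show "X = ?X"
  proof
    fix p
    obtain a where a: "X p = right_invariant_field G a p" using right_invariant_field_surj by metis
    have "a = hamilton_generator p"
    proof (rule symplectic_nondegenerate)
      fix b
      have "symplectic_form G p (X p) (right_invariant_field G b p) = - dH p (right_invariant_field G b p)"
        using L unfolding satisfies_hamilton_equation_def dH_def by blast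
      then show "symplectic_on_generators G p a b = symplectic_on_generators G p (hamilton_generator p) b"
        by (simp add: symplectic_form_def a generator_right_invariant_field hamilton_generator_solves)
    qed
    then show "X p = ?X p" using a by simp
  qed
next
  assume X: "X = ?X"
  show ?L
    unfolding satisfies_hamilton_equation_def
  proof (intro allI)
    fix p w
    obtain b where b: "w = right_invariant_field G b p" using right_invariant_field_surj by metis
    show "symplectic_form G p (X p) w = - tangent_map (phase_charts G) vec_charts H p w"
      using hamilton_generator_solves[of p b]
      by (simp add: X b symplectic_form_def generator_right_invariant_field dH_def)
  qed
qed

lemma phase_chart_tangent:
  assumes g: "g \<in> chart_dom C x"
  shows "has_tangent_map (phase_charts G) vec_charts (\<lambda>q. (chart_map C x (fst q), snd q)) (g, w)
    (\<lambda>v. (tangent_map C vec_charts (chart_map C x) g (fst v), snd v))"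
proof -
  have "has_tangent_map (prod_charts C vec_charts) vec_charts (\<lambda>q. chart_map C x (fst q)) (g, w)
      (\<lambda>v. tangent_map C vec_charts (chart_map C x) g (fst v))"
    by (rule has_tangent_map_compose[OF charted_prod[OF charted(1) charted_vec] charted(1)
          has_tangent_map_fst[OF charted(1) charted_vec]])
      (simp add: chart_map_has_tangent_map[OF smooth_structure g])
  from has_tangent_map_Pair[OF this has_tangent_map_snd[OF charted(1) charted_vec]]
  show ?thesis by (simp only: phase_charts_def prod_vec_charts)
qed

section \<open>Smoothness of the Hamiltonian field in one chart\<close>

context
  fixes x :: 'g
begin

text \<open>The phase chart at \<open>(x, w)\<close> depends on \<open>x\<close> only, so one
  coordinate image and one representative of \<open>H\<close> serve all \<open>w\<close>.\<close>

abbreviation chart_image where "chart_image \<equiv> (chart_map C x ` chart_dom C x) \<times> (UNIV :: ('e dual \<times> 'e dual \<times> 'e) set)"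

abbreviation point :: "'e phase_tangent \<Rightarrow> ('g, 'e) phase" where
  "point y \<equiv> (chart_inv C x (fst y), snd y)"

abbreviation H_rep :: "'e phase_tangent \<Rightarrow> real" where
  "H_rep y \<equiv> H (point y)"

lemma phase_chart_inv:
  "y \<in> chart_image \<Longrightarrow> chart_inv (phase_charts G) (x, w) y = point y"
  using prod_charts_inv[OF charted(1) charted_vec, of "fst y" x "snd y" w]
  by (auto simp: phase_charts_def)

lemma phase_chart_image:
  "chart_map (phase_charts G) (x, w) ` chart_dom (phase_charts G) (x, w) = chart_image"
  by (simp add: phase_charts_def map_prod_surj_on[OF refl refl])

lemma open_phase_chart_image: "open chart_image"
  by (simp add: open_Times open_chart_image[OF charted(1)])

lemma H_rep_smooth: "smooth_on chart_image H_rep"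
proof -
  fix w :: "'e dual \<times> 'e dual \<times> 'e"
  have "smooth_on (chart_map (phase_charts G) (x, w) ` (chart_dom (phase_charts G) (x, w) \<inter> H -` UNIV))
      (id \<circ> H \<circ> chart_inv (phase_charts G) (x, w))"
    using H unfolding smooth_map_def by (metis vec_charts_simps(1,2))
  then have "smooth_on chart_image (\<lambda>y. H (chart_inv (phase_charts G) (x, w) y))"
    by (simp add: phase_chart_image o_def)
  moreover have "smooth_on chart_image (\<lambda>y. H (chart_inv (phase_charts G) (x, w) y)) \<longleftrightarrow>
      smooth_on chart_image H_rep"
    by (rule smooth_on_cong[OF open_phase_chart_image]) (simp only: phase_chart_inv)
  ultimately show ?thesis by (rule iffD1[rotated])
qed

text \<open>In the fixed chart at \<open>x\<close>, \<open>right_field\<close> represents the vector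
  that \<open>TR\<close> describes in the moving preferred chart. Differentials thus become
  derivatives of one smooth function.\<close>

lemma H_rep_derivative:
  assumes y: "y \<in> chart_image"
  shows "frechet_derivative H_rep (at y) (right_field x (fst y) \<eta>, w) =
    dH (point y) (TR G (chart_inv C x (fst y)) \<eta>, w)"
proof -
  let ?\<Phi> = "\<lambda>q. (chart_map C x (fst q), snd q)" and ?U = "chart_dom C x \<times> (UNIV :: ('e dual \<times> 'e dual \<times> 'e) set)"
  have a: "fst y \<in> chart_map C x ` chart_dom C x" using y by auto
  have gD: "chart_inv C x (fst y) \<in> chart_dom C x" by (rule chart_inv_dom[OF charted(1) a])
  have \<Phi>: "?\<Phi> (point y) = y" by (simp add: chart_map_inv[OF charted(1) a])
  have "has_tangent_map vec_charts vec_charts H_rep (?\<Phi> (point y)) (frechet_derivative H_rep (at y))"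
    unfolding \<Phi> has_tangent_map_vec_iff by (rule smooth_on_has_derivative[OF H_rep_smooth y])
  from has_tangent_map_compose[OF charted_phase charted_vec phase_chart_tangent[OF gD] this]
  have "has_tangent_map (phase_charts G) vec_charts H (point y) (\<lambda>v. frechet_derivative H_rep (at y)
      (tangent_map C vec_charts (chart_map C x) (chart_inv C x (fst y)) (fst v), snd v))"
  proof (rule has_tangent_map_transform[OF charted_phase, rotated 3])
    show "open ?U" by (simp add: open_Times open_chart_dom[OF charted(1)])
    show "H_rep (?\<Phi> q) = H q" if "q \<in> ?U" for q
      using that chart_inv_map[OF charted(1), of "fst q" x] by (cases q) auto
  qed (use gD in simp)
  from fun_cong[OF has_tangent_map_unique[OF this dH_has_tangent_map],
      of "(TR G (chart_inv C x (fst y)) \<eta>, w)"]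
  show ?thesis by (simp add: right_field_def)
qed

lemma H_rep_fiber_derivative:
  assumes y: "y \<in> chart_image"
  shows "dH (point y) (0, w) = frechet_derivative H_rep (at y) (0, w)"
proof -
  have gD: "chart_inv C x (fst y) \<in> chart_dom C x" using y by (auto simp: chart_inv_map[OF charted(1)])
  have "right_field x (fst y) 0 = 0" "TR G (chart_inv C x (fst y)) 0 = 0"
    using linear_0[OF bounded_linear.linear[OF TR_bounded_linear]]
      linear_0[OF bounded_linear.linear[OF has_tangent_map_linear[OF chart_map_has_tangent_map[OF smooth_structure gD]]]]
    by (simp_all add: right_field_def)
  then show ?thesis using H_rep_derivative[OF y, of 0 w] by simp
qed

lemma H_rep_derivative_smooth:
  assumes "smooth_on chart_image v"
  shows "smooth_on chart_image (\<lambda>y. frechet_derivative H_rep (at y) (v y))"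
proof -
  obtain B :: "'e set" and \<phi> where F: "frame B \<phi> (\<lambda>b. b)" using frame_ex by blast
  note F4 = frame_Times[OF F frame_Times[OF frame_dual[OF F] frame_Times[OF frame_dual[OF F] F]]]
  show ?thesis
    by (rule smooth_on_derivative_apply[OF F4 open_phase_chart_image
          smooth_on_linear[OF bounded_linear_ident open_phase_chart_image] _ H_rep_smooth assms])
qed

lemma smooth_on_cong_image:
  "smooth_on chart_image f \<Longrightarrow> (\<And>y. y \<in> chart_image \<Longrightarrow> k y = f y) \<Longrightarrow> smooth_on chart_image k"
  using smooth_on_cong[OF open_phase_chart_image] by metis

text \<open>The \<open>i\<close>-th coordinate of \<open>\<delta>\<nu> H\<close> is its pairing with
  the covector \<open>\<phi> i\<close>, hence a derivative of \<open>H_rep\<close> in a constant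
  direction. The lemmas for \<open>\<delta>\<mu>\<close> and \<open>\<delta>\<xi>\<close> follow the
  same pattern.\<close>

lemma delta_nu_smooth: "smooth_on chart_image (\<lambda>y. \<delta>\<nu> H (point y))"
proof -
  obtain B :: "'e set" and \<phi> where F: "frame B \<phi> (\<lambda>b. b)" using frame_ex by blast
  show ?thesis
  proof (rule smooth_on_frame[OF F open_phase_chart_image])
    fix i
    have "smooth_on chart_image (\<lambda>y. frechet_derivative H_rep (at y) (0, 0, Blinfun (\<phi> i), 0))"
      by (rule H_rep_derivative_smooth[OF smooth_on_const[OF open_phase_chart_image]])
    then show "smooth_on chart_image (\<lambda>y. \<phi> i (\<delta>\<nu> H (point y)))"
    proof (rule smooth_on_cong_image)
      fix y :: "'e phase_tangent" assume y: "y \<in> chart_image"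
      obtain a m n z where y': "y = (a, m, n, z)" by (metis prod_cases4)
      show "\<phi> i (\<delta>\<nu> H (point y)) = frechet_derivative H_rep (at y) (0, 0, Blinfun (\<phi> i), 0)"
        using delta_nu_apply[of "Blinfun (\<phi> i)" "chart_inv C x a" m n z] H_rep_fiber_derivative[OF y]
        by (simp add: y' bounded_linear_Blinfun_apply[OF frame_bounded_linear[OF F]])
    qed
  qed
qed

lemma delta_mu_smooth: "smooth_on chart_image (\<lambda>y. \<delta>\<mu> H (point y))"
proof -
  obtain B :: "'e set" and \<phi> where F: "frame B \<phi> (\<lambda>b. b)" using frame_ex by blast
  show ?thesis
  proof (rule smooth_on_frame[OF F open_phase_chart_image])
    fix i
    have "smooth_on chart_image (\<lambda>y. frechet_derivative H_rep (at y) (0, Blinfun (\<phi> i), 0, 0))"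
      by (rule H_rep_derivative_smooth[OF smooth_on_const[OF open_phase_chart_image]])
    then show "smooth_on chart_image (\<lambda>y. \<phi> i (\<delta>\<mu> H (point y)))"
    proof (rule smooth_on_cong_image)
      fix y :: "'e phase_tangent" assume y: "y \<in> chart_image"
      obtain a m n z where y': "y = (a, m, n, z)" by (metis prod_cases4)
      show "\<phi> i (\<delta>\<mu> H (point y)) = frechet_derivative H_rep (at y) (0, Blinfun (\<phi> i), 0, 0)"
        using delta_mu_apply[of "Blinfun (\<phi> i)" "chart_inv C x a" m n z] H_rep_fiber_derivative[OF y]
        by (simp add: y' bounded_linear_Blinfun_apply[OF frame_bounded_linear[OF F]])
    qed
  qed
qed

lemma delta_xi_smooth: "smooth_on chart_image (\<lambda>y. \<delta>\<xi> H (point y))"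
proof -
  obtain B :: "'e set" and \<phi> where F: "frame B \<phi> (\<lambda>b. b)" using frame_ex by blast
  show ?thesis
  proof (rule smooth_on_frame[OF frame_dual[OF F] open_phase_chart_image])
    fix i
    have "smooth_on chart_image (\<lambda>y. frechet_derivative H_rep (at y) (0, 0, 0, i))"
      by (rule H_rep_derivative_smooth[OF smooth_on_const[OF open_phase_chart_image]])
    then show "smooth_on chart_image (\<lambda>y. blinfun_apply (\<delta>\<xi> H (point y)) i)"
    proof (rule smooth_on_cong_image)
      fix y :: "'e phase_tangent" assume y: "y \<in> chart_image"
      obtain a m n z where y': "y = (a, m, n, z)" by (metis prod_cases4)
      show "blinfun_apply (\<delta>\<xi> H (point y)) i = frechet_derivative H_rep (at y) (0, 0, 0, i)"
        using delta_xi_apply[of "chart_inv C x a" m n z i] H_rep_fiber_derivative[OF y]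
        by (simp add: y')
    qed
  qed
qed

lemma right_field_smooth_apply:
  assumes "smooth_on chart_image v"
  shows "smooth_on chart_image (\<lambda>y. right_field x (fst y) (v y))"
proof -
  obtain B :: "'e set" and \<phi> where F: "frame B \<phi> (\<lambda>b. b)" using frame_ex by blast
  have "smooth_on chart_image (\<lambda>y. (fst y, v y))"
    by (rule smooth_on_Pair[OF open_phase_chart_image
          smooth_on_linear[OF bounded_linear_fst open_phase_chart_image] assms])
  from smooth_on_compose[OF frame_Times[OF F F] open_phase_chart_image _ this right_field_smooth]
  show ?thesis by auto
qed

text \<open>\<open>\<delta>g\<close> alone refers to the moving preferred chart; its pullback to the
  identity does not. Paired with a fixed vector \<open>i\<close>, the pullback is the derivative of
  \<open>H_rep\<close> along the smooth field \<open>right_field\<close> of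
  \<open>i\<close>.\<close>

lemma TR_dual_delta_g_smooth:
  "smooth_on chart_image (\<lambda>y. TR_dual G (chart_inv C x (fst y)) (\<delta>g G H (point y)))"
proof -
  obtain B :: "'e set" and \<phi> where F: "frame B \<phi> (\<lambda>b. b)" using frame_ex by blast
  show ?thesis
  proof (rule smooth_on_frame[OF frame_dual[OF F] open_phase_chart_image])
    fix i
    have "smooth_on chart_image (\<lambda>y. frechet_derivative H_rep (at y) (right_field x (fst y) i, 0))"
      by (rule H_rep_derivative_smooth[OF smooth_on_Pair[OF open_phase_chart_image
              right_field_smooth_apply[OF smooth_on_const] smooth_on_const]])
        (rule open_phase_chart_image)+
    then show "smooth_on chart_image
        (\<lambda>y. blinfun_apply (TR_dual G (chart_inv C x (fst y)) (\<delta>g G H (point y))) i)"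
      by (rule smooth_on_cong_image) (simp only: TR_dual_apply delta_g_apply H_rep_derivative)
  qed
qed

text \<open>In the chart at \<open>x\<close> the group component turns into
  \<open>right_field\<close> of \<open>\<delta>\<nu> H\<close>; the others are built from smooth
  functions by the bilinear maps \<open>ad_star\<close> and \<open>lie_bracket\<close>.\<close>

lemma hamilton_field_smooth:
  "smooth_on chart_image (\<lambda>y.
    case right_invariant_field G (hamilton_generator (point y)) (point y) of (u, w) \<Rightarrow>
      (tangent_map C vec_charts (chart_map C x) (chart_inv C x (fst y)) u, w))"
proof -
  note o = open_phase_chart_image
  have coords: "smooth_on chart_image (\<lambda>y. fst (snd y))" "smooth_on chart_image (\<lambda>y. fst (snd (snd y)))"
      "smooth_on chart_image (\<lambda>y. snd (snd (snd y)))"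
    by (rule smooth_on_linear[OF _ o], intro bounded_linear_fst_comp bounded_linear_snd_comp
        bounded_linear_fst bounded_linear_snd)+
  let ?n = "\<lambda>y. \<delta>\<nu> H (point y)" and ?m = "\<lambda>y. \<delta>\<mu> H (point y)" and ?x = "\<lambda>y. \<delta>\<xi> H (point y)"
  have "smooth_on chart_image (\<lambda>y. (right_field x (fst y) (?n y),
      ?x y + ad_star G (?n y) (fst (snd y)),
      ad_star G (?m y) (fst (snd y)) - TR_dual G (chart_inv C x (fst y)) (\<delta>g G H (point y))
        + ad_star G (?n y) (fst (snd (snd y))) - ad_star G (snd (snd (snd y))) (?x y),
      - ?m y + lie_bracket G (snd (snd (snd y))) (?n y)))"
    by (intro smooth_on_Pair[OF o] smooth_on_add[OF o] smooth_on_diff[OF o] smooth_on_minus[OF o]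
        smooth_on_bilinear[OF ad_star_bilinear o] smooth_on_bilinear[OF lie_bracket_bilinear o]
        right_field_smooth_apply delta_nu_smooth delta_mu_smooth delta_xi_smooth TR_dual_delta_g_smooth
        coords)
  then show ?thesis
    by (rule smooth_on_cong_image) (auto simp: right_field_def)
qed

end

lemma hamilton_vector_field_smooth:
  "smooth_vector_field (phase_charts G) (\<lambda>p. right_invariant_field G (hamilton_generator p) p)"
  unfolding smooth_vector_field_def
proof
  fix p :: "('g, 'e) phase"
  obtain x w where p: "p = (x, w)" by (cases p)
  let ?X = "\<lambda>p. right_invariant_field G (hamilton_generator p) p"
  let ?S = "(chart_map C x ` chart_dom C x) \<times> (UNIV :: ('e dual \<times> 'e dual \<times> 'e) set)"
  have "smooth_on ?S (\<lambda>y. tangent_map (phase_charts G) vec_charts (chart_map (phase_charts G) p)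
      (chart_inv (phase_charts G) p y) (?X (chart_inv (phase_charts G) p y)))"
  proof (rule smooth_on_cong_image[OF hamilton_field_smooth])
    fix y assume y: "y \<in> ?S"
    have gD: "chart_inv C x (fst y) \<in> chart_dom C x" using y by (auto simp: chart_inv_map[OF charted(1)])
    have "chart_map (phase_charts G) p = (\<lambda>q. (chart_map C x (fst q), snd q))"
      by (auto simp: p phase_charts_def fun_eq_iff)
    then show "tangent_map (phase_charts G) vec_charts (chart_map (phase_charts G) p)
        (chart_inv (phase_charts G) p y) (?X (chart_inv (phase_charts G) p y)) =
      (case ?X (chart_inv C x (fst y), snd y) of (u, w) \<Rightarrow>
        (tangent_map C vec_charts (chart_map C x) (chart_inv C x (fst y)) u, w))"
      using phase_chart_inv[OF y, of w] has_tangent_map_eq[OF phase_chart_tangent[OF gD]]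
      by (simp add: p case_prod_beta)
  qed
  then show "smooth_on (chart_map (phase_charts G) p ` chart_dom (phase_charts G) p)
      (\<lambda>y. tangent_map (phase_charts G) vec_charts (chart_map (phase_charts G) p)
        (chart_inv (phase_charts G) p y) (?X (chart_inv (phase_charts G) p y)))"
    by (simp only: p phase_chart_image)
qed

section \<open>The Hamiltonian vector field and its integral curves\<close>

lemma hamiltonian_vector_field_eq:
  "hamiltonian_vector_field G H = (\<lambda>p. right_invariant_field G (hamilton_generator p) p)"
  unfolding hamiltonian_vector_field_def
  by (rule the_equality) (auto simp: satisfies_hamilton_equation_iff hamilton_vector_field_smooth)

lemma hamiltonian_integral_curve_iff:
  "has_velocity (phase_charts G) (\<lambda>t. (g t, \<mu> t, \<nu> t, \<xi> t))
      (hamiltonian_vector_field G H (g t, \<mu> t, \<nu> t, \<xi> t)) t \<longleftrightarrow>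
    (let p = (g t, \<mu> t, \<nu> t, \<xi> t) in
      has_velocity (charts G) g (TR G (g t) (\<delta>\<nu> H p)) t \<and>
      (\<mu> has_vector_derivative (\<delta>\<xi> H p + ad_star G (\<delta>\<nu> H p) (\<mu> t))) (at t) \<and>
      (\<nu> has_vector_derivative
         (ad_star G (\<delta>\<mu> H p) (\<mu> t) + ad_star G (\<delta>\<nu> H p) (\<nu> t)
          - TR_dual G (g t) (\<delta>g G H p) - ad_star G (\<xi> t) (\<delta>\<xi> H p))) (at t) \<and>
      (\<xi> has_vector_derivative (- \<delta>\<mu> H p + lie_bracket G (\<xi> t) (\<delta>\<nu> H p))) (at t))"
proof -
  have triple: "((\<lambda>t. (\<alpha> t, \<beta> t, \<gamma> t)) has_vector_derivative (a, b, c)) (at t) \<longleftrightarrow>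
      (\<alpha> has_vector_derivative a) (at t) \<and> (\<beta> has_vector_derivative b) (at t) \<and>
      (\<gamma> has_vector_derivative c) (at t)"
    for \<alpha> \<beta> :: "real \<Rightarrow> 'e dual" and \<gamma> :: "real \<Rightarrow> 'e" and a b c
    using has_velocity_Pair_iff[OF charted_vec charted_vec, of \<alpha> "\<lambda>t. (\<beta> t, \<gamma> t)" a "(b, c)" t]
      has_velocity_Pair_iff[OF charted_vec charted_vec, of \<beta> \<gamma> b c t]
    by (simp add: prod_vec_charts has_velocity_vec_iff)
  show ?thesis
    by (simp add: Let_def hamiltonian_vector_field_eq phase_charts_def
        has_velocity_Pair_iff[OF charted(1) charted_vec] has_velocity_vec_iff triple algebra_simps)
qed

end

end

theorem mainTheorem10:
  fixes G :: "('g::{t2_space, second_countable_topology}, 'e::{real_inner, complete_space})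
      charted_group"
    and H :: "('g, 'e) phase \<Rightarrow> real"
  assumes "lie_group G"
    and "smooth_map (phase_charts G) vec_charts H"
  shows "(\<exists>!X. smooth_vector_field (phase_charts G) X \<and> satisfies_hamilton_equation G H X) \<and>
    (\<forall>X. satisfies_hamilton_equation G H X \<longrightarrow> X = hamiltonian_vector_field G H) \<and>
    (\<forall>g \<mu> \<nu> \<xi>. let p = (g, \<mu>, \<nu>, \<xi>) in
       hamiltonian_vector_field G H p =
         right_invariant_field G
           (\<delta>\<nu> H p, \<delta>\<xi> H p, ad_star G (\<delta>\<mu> H p) \<mu> - TR_dual G g (\<delta>g G H p), - \<delta>\<mu> H p) p) \<and>
    (\<forall>I g \<mu> \<nu> \<xi>. open I \<longrightarrow>
       integral_curve (phase_charts G) (hamiltonian_vector_field G H) I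
         (\<lambda>t. (g t, \<mu> t, \<nu> t, \<xi> t)) \<longleftrightarrow>
       (\<forall>t\<in>I. let p = (g t, \<mu> t, \<nu> t, \<xi> t) in
          has_velocity (charts G) g (TR G (g t) (\<delta>\<nu> H p)) t \<and>
          (\<mu> has_vector_derivative
             (\<delta>\<xi> H p + ad_star G (\<delta>\<nu> H p) (\<mu> t))) (at t) \<and>
          (\<nu> has_vector_derivative
             (ad_star G (\<delta>\<mu> H p) (\<mu> t) + ad_star G (\<delta>\<nu> H p) (\<nu> t)
              - TR_dual G (g t) (\<delta>g G H p) - ad_star G (\<xi> t) (\<delta>\<xi> H p))) (at t) \<and>
          (\<xi> has_vector_derivative
             (- \<delta>\<mu> H p + lie_bracket G (\<xi> t) (\<delta>\<nu> H p))) (at t)))"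
proof -
  interpret lie_group G by (rule assms)
  note iff = satisfies_hamilton_equation_iff[OF assms(2)]
    and smooth = hamilton_vector_field_smooth[OF assms(2)]
    and eq = hamiltonian_vector_field_eq[OF assms(2)]
  show ?thesis
  proof (intro conjI allI impI)
    show "\<exists>!X. smooth_vector_field (phase_charts G) X \<and> satisfies_hamilton_equation G H X"
      using smooth by (auto simp: iff)
  next
    fix X assume "satisfies_hamilton_equation G H X"
    then show "X = hamiltonian_vector_field G H" by (simp only: iff eq)
  next
    fix g \<mu> \<nu> \<xi>
    show "let p = (g, \<mu>, \<nu>, \<xi>) in hamiltonian_vector_field G H p = right_invariant_field G
        (\<delta>\<nu> H p, \<delta>\<xi> H p, ad_star G (\<delta>\<mu> H p) \<mu> - TR_dual G g (\<delta>g G H p), - \<delta>\<mu> H p) p"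
      by (simp only: Let_def eq hamilton_generator.simps[OF assms(2)])
  qed (simp only: integral_curve_def hamiltonian_integral_curve_iff[OF assms(2)])
qed

end
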